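(* Let $\widetilde G(z)\in\mathcal{RL}_n^p$ and let $\widetilde R=(\widetilde A,\widetilde B,\widetilde C,\widetilde D)$ be a balanced realization of $\widetilde G(z)$ in real Schur form $$\widetilde A=\begin{pmatrix}W_l&\star&\cdots&\star\\0&W_{l-1}&\ddots&\vdots\\\vdots&\ddots&\ddots&\star\\0&\cdots&0&W_1\end{pmatrix},$$ where for $j=1,\dots,l$, $W_j$ is either a real number or a real $2\times2$ block with complex conjugate eigenvalues. Let $$\widetilde A=\begin{pmatrix}W_l&\hat A^*\\0&A\end{pmatrix},\qquad\widetilde C=\begin{pmatrix}U_l&\hat C\end{pmatrix},\qquad\widetilde B=\begin{pmatrix}\hat B^*\\ B\end{pmatrix},$$ where $U_l$ and $\hat B$ are $p\times n_l$, $n_l$ being the size of $W_l$. Then $\widetilde G=T_{\hat\Theta_{W_l,U_l,0}}(G)$ for some lossless function $G(z)$. A realization $R$ of $G(z)$ can be computed by reverting the recursion $$\begin{pmatrix}\widetilde D&\widetilde C\\\widetilde B&\widetilde A\end{pmatrix}=\begin{pmatrix}\mathcal{U}&0\\0&I_{n-n_l}\end{pmatrix}\begin{pmatrix}D&0&C\\0&I_{n_l}&0\\ B&0&A\end{pmatrix}\begin{pmatrix}\mathcal{V}^*&0\\0&I_{n-n_l}\end{pmatrix},\qquad(\mathcal{U},\mathcal{V})=\tau(W_l,U_l,0);$$ it is in (real) Schur form and is given by $R=(A,B,C,D)$, where $$C=\hat C+U_l(I_{n_l}-W_l)^{-1}\hat A^*,\qquad D=\widetilde D+U_l(I_{n_l}-W_l)^{-1}\hat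 B^*.$$
   Context: $^*$ denotes conjugate transpose, $M^{-*}=(M^{-1})^*$, $J=\begin{pmatrix}I_p&0\\0&-I_p\end{pmatrix}$; square roots of positive definite matrices are the Hermitian positive ones. A $p\times p$ rational matrix function $G$ is lossless if $G(z)G(z)^*\le I_p$ for $|z|>1$, with equality for $|z|=1$; it is real if $\overline{G(z)}=G(\bar z)$. $\mathcal{RL}_n^p$ is the set of real $p\times p$ lossless functions of McMillan degree $n$. A realization $(A,B,C,D)$ of $G$ means $G(z)=D+C(zI-A)^{-1}B$; for a lossless function, a balanced realization is a minimal realization for which the realization matrix $\begin{pmatrix}D&C\\ B&A\end{pmatrix}$ is unitary (in the lemma the matrices of $\widetilde R$ are real). For $\Theta=(\Theta_{ij})_{i,j=1,2}$ with $p\times p$ blocks, $T_\Theta(F)=(\Theta_{11}F+\Theta_{12})(\Theta_{21}F+\Theta_{22})^{-1}$. Let $W\in\mathbb{C}^{\delta\times\delta}$ be stable (eigenvalues in the open unit disk), $U,V\in\mathbb{C}^{p\times\delta}$, $(U,W)$ observable with $U^*U+W^*W=I_\delta$, and such that the solution $P$ of $P-W^*PW=U^*U-V^*V$ is positive definite. (In the lemma, $\delta=n_l$, $W=W_l$, $U=U_l$, $V=0$.) Let $T=P^{1/2}$, $\tilde U=UT^{-1}$, $\tilde W=TWT^{-1}$, $\tilde V=VT^{-1}$, $X=I_p-U(I_\delta-W^* )^{-1}U^*$, $Y=(I_\delta-W)(I_\delta-W^* )^{-1}U^*$, $K=\tilde U^*\tilde U+\tilde W^*\tilde W=I_\delta+\tilde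 V^*\tilde V$, $L=\tilde U^*X+\tilde W^*TY$, $Z=X^*X+Y^*P^{-1}Y$. Then $\tau(W,U,V)=(\mathcal{U},\mathcal{V})$ with the unitary matrices $$\mathcal{U}=\begin{pmatrix}X&\tilde U\\ TY&\tilde W\end{pmatrix}\begin{pmatrix}Z^{1/2}&0\\-K^{-1}LZ^{1/2}&K^{-1/2}\end{pmatrix},\qquad\mathcal{V}=\begin{pmatrix}(I_p+\tilde V\tilde V^* )^{-1/2}&\tilde V(I_\delta+\tilde V^*\tilde V)^{-1/2}\\-\tilde V^*(I_p+\tilde V\tilde V^* )^{-1/2}&(I_\delta+\tilde V^*\tilde V)^{-1/2}\end{pmatrix}.$$ Write $\mathcal{U}=\begin{pmatrix}M_u&\alpha_u\\\beta_u^*&K_u\end{pmatrix}$, $\mathcal{V}=\begin{pmatrix}M_v&\alpha_v\\\beta_v^*&K_v\end{pmatrix}$ ($M_u,M_v$ of size $p\times p$), $M=\begin{pmatrix}M_u&0\\0&M_v\end{pmatrix}$, $\alpha=\begin{pmatrix}\alpha_u\\\alpha_v\end{pmatrix}$, $\beta=\begin{pmatrix}\beta_u\\\beta_v\end{pmatrix}$, $H_{\mathcal{U},\mathcal{V}}=M+\alpha(K_v-K_u)^{-1}\beta^*J$. With $\mathcal{C}=\begin{pmatrix}U\\ V\end{pmatrix}$, $\Theta_{W,U,V}(z)=I_{2p}-(z-1)\mathcal{C}(zI_\delta-W)^{-1}P^{-1}(I_\delta-W)^{-*}\mathcal{C}^*J$, and $\hat\Theta_{W,U,V}=\Theta_{W,U,V}H_{\mathcal{U},\mathcal{V}}$.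 *)

theory Defs
  imports
    "Jordan_Normal_Form.Schur_Decomposition"
    "HOL-Computational_Algebra.Normalized_Fraction"
    "HOL-Computational_Algebra.Field_as_Ring"
begin

section \<open>Matrix preliminaries\<close>

text \<open>For a singular matrix the value of \<^term>\<open>mat_inv\<close> is unspecified.\<close>

definition mat_inv :: "'a :: field mat \<Rightarrow> 'a mat" where
  "mat_inv M = the (mat_inverse M)"

definition append_cols :: "'a :: zero mat \<Rightarrow> 'a mat \<Rightarrow> 'a mat" where
  "append_cols M N = four_block_mat M N (0\<^sub>m 0 (dim_col M)) (0\<^sub>m 0 (dim_col N))"

definition block_diag :: "'a :: zero mat \<Rightarrow> 'a mat \<Rightarrow> 'a mat" where
  "block_diag M N =
     four_block_mat M (0\<^sub>m (dim_row M) (dim_col N)) (0\<^sub>m (dim_row N) (dim_col M)) N"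

definition real_mat :: "complex mat \<Rightarrow> bool" where
  "real_mat M \<longleftrightarrow> elements_mat M \<subseteq> \<real>"

definition unitary_mat :: "complex mat \<Rightarrow> bool" where
  "unitary_mat M \<longleftrightarrow> square_mat M \<and>
     M * mat_adjoint M = 1\<^sub>m (dim_row M) \<and> mat_adjoint M * M = 1\<^sub>m (dim_row M)"

definition hermitian_mat :: "complex mat \<Rightarrow> bool" where
  "hermitian_mat M \<longleftrightarrow> mat_adjoint M = M"

definition pos_semidef :: "nat \<Rightarrow> complex mat \<Rightarrow> bool" where
  "pos_semidef n M \<longleftrightarrow> M \<in> carrier_mat n n \<and> hermitian_mat M \<and>
     (\<forall>v \<in> carrier_vec n. 0 \<le> Re ((M *\<^sub>v v) \<bullet>c v))"

definition pos_def :: "nat \<Rightarrow> complex mat \<Rightarrow> bool" where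
  "pos_def n M \<longleftrightarrow> M \<in> carrier_mat n n \<and> hermitian_mat M \<and>
     (\<forall>v \<in> carrier_vec n. v \<noteq> 0\<^sub>v n \<longrightarrow> 0 < Re ((M *\<^sub>v v) \<bullet>c v))"

definition mat_sqrt :: "complex mat \<Rightarrow> complex mat" where
  "mat_sqrt M = (THE S. pos_def (dim_row M) S \<and> S * S = M)"

definition stable_mat :: "complex mat \<Rightarrow> bool" where
  "stable_mat W \<longleftrightarrow> (\<forall>e. eigenvalue W e \<longrightarrow> cmod e < 1)"

definition observable :: "complex mat \<Rightarrow> complex mat \<Rightarrow> bool" where
  "observable U W \<longleftrightarrow>
     (\<forall>x \<in> carrier_vec (dim_row W).
        (\<forall>k. (U * W ^\<^sub>m k) *\<^sub>v x = 0\<^sub>v (dim_row U)) \<longrightarrow> x = 0\<^sub>v (dim_row W))"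


section \<open>Rational matrix functions\<close>

text \<open>
  A rational matrix function is a matrix over the field of rational functions in one
  indeterminate over the complex numbers, so that equality of matrices is equality of rational
  functions. The fraction returned by \<^term>\<open>quot_of_fract\<close> is in lowest terms, so its
  denominator vanishes exactly at the poles.
\<close>

definition rf_const :: "complex \<Rightarrow> complex poly fract" where
  "rf_const c = Fraction_Field.Fract [:c:] 1"

definition rf_var :: "complex poly fract" where
  "rf_var = Fraction_Field.Fract [:0, 1:] 1"

definition rf_pole :: "complex poly fract \<Rightarrow> complex \<Rightarrow> bool" where
  "rf_pole f z \<longleftrightarrow> poly (snd (quot_of_fract f)) z = 0"

definition rf_eval :: "complex poly fract \<Rightarrow> complex \<Rightarrow> complex" where
  "rf_eval f z = poly (fst (quot_of_fract f)) z / poly (snd (quot_of_fract f)) z"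

abbreviation const_mat :: "complex mat \<Rightarrow> complex poly fract mat" where
  "const_mat \<equiv> map_mat rf_const"

definition analytic_at_pt :: "complex poly fract mat \<Rightarrow> complex \<Rightarrow> bool" where
  "analytic_at_pt G z \<longleftrightarrow> (\<forall>f \<in> elements_mat G. \<not> rf_pole f z)"

definition mat_eval :: "complex poly fract mat \<Rightarrow> complex \<Rightarrow> complex mat" where
  "mat_eval G z = map_mat (\<lambda>f. rf_eval f z) G"

definition lossless :: "nat \<Rightarrow> complex poly fract mat \<Rightarrow> bool" where
  "lossless p G \<longleftrightarrow> G \<in> carrier_mat p p \<and>
     (\<forall>z. cmod z > 1 \<longrightarrow> analytic_at_pt G z \<and>
        pos_semidef p (1\<^sub>m p - mat_eval G z * mat_adjoint (mat_eval G z))) \<and>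
     (\<forall>z. cmod z = 1 \<longrightarrow> analytic_at_pt G z \<and>
        mat_eval G z * mat_adjoint (mat_eval G z) = 1\<^sub>m p)"

definition real_function :: "complex poly fract mat \<Rightarrow> bool" where
  "real_function G \<longleftrightarrow>
     (\<forall>z. analytic_at_pt G z \<and> analytic_at_pt G (cnj z) \<longrightarrow>
        map_mat cnj (mat_eval G z) = mat_eval G (cnj z))"

definition realization ::
  "nat \<Rightarrow> nat \<Rightarrow> complex mat \<Rightarrow> complex mat \<Rightarrow> complex mat \<Rightarrow> complex mat \<Rightarrow>
   complex poly fract mat \<Rightarrow> bool" where
  "realization p n A B C D G \<longleftrightarrow>
     A \<in> carrier_mat n n \<and> B \<in> carrier_mat n p \<and> C \<in> carrier_mat p n \<and> D \<in> carrier_mat p p \<and>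
     G = const_mat D + const_mat C * mat_inv (rf_var \<cdot>\<^sub>m 1\<^sub>m n - const_mat A) * const_mat B"

text \<open>
  The McMillan degree of a proper function is the smallest state space dimension of a
  realization. Lossless functions are bounded near infinity, hence proper.
\<close>

definition mcmillan_degree :: "nat \<Rightarrow> complex poly fract mat \<Rightarrow> nat" where
  "mcmillan_degree p G = (LEAST n. \<exists>A B C D. realization p n A B C D G)"

definition minimal_realization ::
  "nat \<Rightarrow> nat \<Rightarrow> complex mat \<Rightarrow> complex mat \<Rightarrow> complex mat \<Rightarrow> complex mat \<Rightarrow>
   complex poly fract mat \<Rightarrow> bool" where
  "minimal_realization p n A B C D G \<longleftrightarrow>
     realization p n A B C D G \<and> n = mcmillan_degree p G"

definition RL :: "nat \<Rightarrow> nat \<Rightarrow> complex poly fract mat set" where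
  "RL n p = {G. real_function G \<and> lossless p G \<and> mcmillan_degree p G = n}"

text \<open>To be used for lossless functions only.\<close>

definition balanced_realization ::
  "nat \<Rightarrow> nat \<Rightarrow> complex mat \<Rightarrow> complex mat \<Rightarrow> complex mat \<Rightarrow> complex mat \<Rightarrow>
   complex poly fract mat \<Rightarrow> bool" where
  "balanced_realization p n A B C D G \<longleftrightarrow>
     minimal_realization p n A B C D G \<and> unitary_mat (four_block_mat D C B A)"


section \<open>Real Schur form\<close>

text \<open>The diagonal blocks are listed from the top left to the bottom right.\<close>

fun block_upper_triangular :: "complex mat list \<Rightarrow> complex mat \<Rightarrow> bool" where
  "block_upper_triangular [] M \<longleftrightarrow> M \<in> carrier_mat 0 0"
| "block_upper_triangular (W # Ws) M \<longleftrightarrow> square_mat W \<and>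
     (\<exists>N M'. N \<in> carrier_mat (dim_row W) (dim_row M') \<and> block_upper_triangular Ws M' \<and>
        M = four_block_mat W N (0\<^sub>m (dim_row M') (dim_col W)) M')"

definition schur_block :: "complex mat \<Rightarrow> bool" where
  "schur_block W \<longleftrightarrow> real_mat W \<and>
     (W \<in> carrier_mat 1 1 \<or>
      W \<in> carrier_mat 2 2 \<and> (\<exists>e. e \<notin> \<real> \<and> eigenvalue W e \<and> eigenvalue W (cnj e)))"

definition real_schur_form :: "complex mat list \<Rightarrow> complex mat \<Rightarrow> bool" where
  "real_schur_form Ws M \<longleftrightarrow>
     real_mat M \<and> (\<forall>W \<in> set Ws. schur_block W) \<and> block_upper_triangular Ws M"

text \<open>A quadruple of real matrices is in real Schur form if its dynamics matrix is.\<close>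

definition real_schur_quadruple ::
  "complex mat list \<Rightarrow> complex mat \<Rightarrow> complex mat \<Rightarrow> complex mat \<Rightarrow> complex mat \<Rightarrow> bool" where
  "real_schur_quadruple Ws A B C D \<longleftrightarrow>
     real_schur_form Ws A \<and> real_mat B \<and> real_mat C \<and> real_mat D"


section \<open>Interpolation data, the unitary pair and the linear fractional map\<close>

definition stein_solution :: "complex mat \<Rightarrow> complex mat \<Rightarrow> complex mat \<Rightarrow> complex mat" where
  "stein_solution W U V = (THE P. P \<in> carrier_mat (dim_row W) (dim_row W) \<and>
     P - mat_adjoint W * P * W = mat_adjoint U * U - mat_adjoint V * V)"

definition admissible :: "nat \<Rightarrow> nat \<Rightarrow> complex mat \<Rightarrow> complex mat \<Rightarrow> complex mat \<Rightarrow> bool" where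
  "admissible p d W U V \<longleftrightarrow>
     W \<in> carrier_mat d d \<and> U \<in> carrier_mat p d \<and> V \<in> carrier_mat p d \<and>
     stable_mat W \<and> observable U W \<and>
     mat_adjoint U * U + mat_adjoint W * W = 1\<^sub>m d \<and>
     pos_def d (stein_solution W U V)"

definition tau_fst :: "complex mat \<Rightarrow> complex mat \<Rightarrow> complex mat \<Rightarrow> complex mat" where
  "tau_fst W U V =
    (let p = dim_row U; d = dim_row W;
         P = stein_solution W U V;
         T = mat_sqrt P;
         Ut = U * mat_inv T;
         Wt = T * W * mat_inv T;
         R = mat_inv (1\<^sub>m d - mat_adjoint W);
         X = 1\<^sub>m p - U * R * mat_adjoint U;
         Y = (1\<^sub>m d - W) * R * mat_adjoint U;
         K = mat_adjoint Ut * Ut + mat_adjoint Wt * Wt;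
         L = mat_adjoint Ut * X + mat_adjoint Wt * T * Y;
         Z = mat_adjoint X * X + mat_adjoint Y * mat_inv P * Y
     in four_block_mat X Ut (T * Y) Wt *
        four_block_mat (mat_sqrt Z) (0\<^sub>m p d)
          (- (mat_inv K * L * mat_sqrt Z)) (mat_inv (mat_sqrt K)))"

definition tau_snd :: "complex mat \<Rightarrow> complex mat \<Rightarrow> complex mat \<Rightarrow> complex mat" where
  "tau_snd W U V =
    (let p = dim_row U; d = dim_row W;
         T = mat_sqrt (stein_solution W U V);
         Vt = V * mat_inv T;
         E = mat_inv (mat_sqrt (1\<^sub>m p + Vt * mat_adjoint Vt));
         F = mat_inv (mat_sqrt (1\<^sub>m d + mat_adjoint Vt * Vt))
     in four_block_mat E (Vt * F) (- (mat_adjoint Vt * E)) F)"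

definition tau :: "complex mat \<Rightarrow> complex mat \<Rightarrow> complex mat \<Rightarrow> complex mat \<times> complex mat" where
  "tau W U V = (tau_fst W U V, tau_snd W U V)"

definition sign_mat :: "nat \<Rightarrow> complex mat" where
  "sign_mat p = block_diag (1\<^sub>m p) (- 1\<^sub>m p)"

text \<open>Here \<^term>\<open>bu\<close> and \<^term>\<open>bv\<close> are the adjoints of the blocks of the matrix beta.\<close>

definition H_mat :: "nat \<Rightarrow> complex mat \<times> complex mat \<Rightarrow> complex mat" where
  "H_mat p UV =
    (let (Mu, au, bu, Ku) = split_block (fst UV) p p;
         (Mv, av, bv, Kv) = split_block (snd UV) p p
     in block_diag Mu Mv +
        (au @\<^sub>r av) * mat_inv (Kv - Ku) * append_cols bu bv * sign_mat p)"

definition Theta :: "complex mat \<Rightarrow> complex mat \<Rightarrow> complex mat \<Rightarrow> complex poly fract mat" where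
  "Theta W U V =
    (let p = dim_row U; d = dim_row W; CC = U @\<^sub>r V
     in 1\<^sub>m (2 * p) - (rf_var - 1) \<cdot>\<^sub>m
          (const_mat CC * mat_inv (rf_var \<cdot>\<^sub>m 1\<^sub>m d - const_mat W) *
           const_mat (mat_inv (stein_solution W U V) * mat_adjoint (mat_inv (1\<^sub>m d - W)) *
             mat_adjoint CC * sign_mat p)))"

definition Theta_hat :: "complex mat \<Rightarrow> complex mat \<Rightarrow> complex mat \<Rightarrow> complex poly fract mat" where
  "Theta_hat W U V = Theta W U V * const_mat (H_mat (dim_row U) (tau W U V))"

definition lft_defined ::
  "nat \<Rightarrow> complex poly fract mat \<Rightarrow> complex poly fract mat \<Rightarrow> bool" where
  "lft_defined p Th F \<longleftrightarrow>
    (let (Th11, Th12, Th21, Th22) = split_block Th p p in invertible_mat (Th21 * F + Th22))"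

definition lft ::
  "nat \<Rightarrow> complex poly fract mat \<Rightarrow> complex poly fract mat \<Rightarrow> complex poly fract mat" where
  "lft p Th F =
    (let (Th11, Th12, Th21, Th22) = split_block Th p p
     in (Th11 * F + Th12) * mat_inv (Th21 * F + Th22))"

text \<open>
  The right-hand side of the recursion for realization matrices; the states of dimension
  \<^term>\<open>d\<close> are put in front of the states of dimension \<^term>\<open>m\<close> of the quadruple.
\<close>

definition recursion_mat ::
  "nat \<Rightarrow> nat \<Rightarrow> nat \<Rightarrow> complex mat \<times> complex mat \<Rightarrow>
   complex mat \<Rightarrow> complex mat \<Rightarrow> complex mat \<Rightarrow> complex mat \<Rightarrow> complex mat" where
  "recursion_mat p d m UV A B C D =
     block_diag (fst UV) (1\<^sub>m m) *
     four_block_mat (block_diag D (1\<^sub>m d)) (C @\<^sub>r 0\<^sub>m d m) (append_cols B (0\<^sub>m m d)) A *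
     block_diag (mat_adjoint (snd UV)) (1\<^sub>m m)"

end

theory Submission
  imports Defs "Jordan_Normal_Form.Spectral_Radius" "HOL-Computational_Algebra.Polynomial_Factorial"
begin

text \<open>
  When \<open>V = 0\<close>, the interpolation problem behind \<open>\<Theta>\<close> degenerates.
  The columns of the unitary realization matrix that belong to the leading block of states consist of
  \<open>U\<close>, \<open>W\<close> and zeros. They are orthonormal, so the identity solves the Stein equation (stein_solution_normalized),
  and the unitary pair reduces to the completion of \<open>(U, W)\<close> to a unitary matrix with
  blocks \<open>X\<close>, \<open>U\<close>, \<open>Y\<close>, \<open>W\<close>, paired with the
  identity (tau_zero). The normalizing factor \<open>H\<close> is the identity,
  \<open>\<Theta>\<close> is block diagonal with blocks \<open>\<theta>\<close> and
  \<open>I\<close>, where \<open>\<theta>\<close> is the transfer function of that unitary matrix,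
  and the linear fractional map is multiplication by \<open>\<theta>\<close> (Theta_hat_zero,
  lft_zero).

  The claim thus becomes a factorization \<open>\<theta> G\<close> of the given function. A
  product of transfer functions has a block triangular realization, and a triangular realization
  comes from a product with left factor \<open>\<theta>\<close> as soon as its first block rows
  are multiples of \<open>(X, Y)\<close> (triangular_factorization). They are: the columns of the
  given realization matrix are orthogonal to \<open>(U, W)\<close>, and \<open>(X, Y)\<close>
  spans the orthogonal complement. The coordinates in this basis are unique, and the explicit form
  of \<open>X\<close> and \<open>Y\<close> gives the formulas for \<open>C\<close> and
  \<open>D\<close> (XY_complete). For the same reason the recursion determines the remaining
  realization (recursion_mat_zero).

  The remaining realization matrix is again unitary (unitary_remainder), and for a unitary
  realization \<open>I - G(z) G(z)\<^sup>* = (\<bar>z\<bar>\<^sup>2 - 1) C F F\<^sup>*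
  C\<^sup>*\<close> with \<open>F\<close> the inverse of \<open>z I - A\<close>
  (realization_defect). If \<open>A\<close> is stable, this shows that \<open>G\<close> is
  lossless. Stability is where minimality enters: a unitary realization with an eigenvalue on the
  unit circle has an eigenvector that gives no output, and the corresponding state can be removed
  (balanced_realization_stable). Stability of \<open>W\<close> also yields uniqueness for the
  Stein equation and observability, because the powers of \<open>W\<close> tend to zero.
\<close>

section \<open>Ring arithmetic for rectangular matrices\<close>

text \<open>
  Matrices of all sizes share one type, so the ring laws hold only for matching dimensions. Stated
  with side conditions on \<^const>\<open>dim_row\<close> and \<^const>\<open>dim_col\<close>,
  which the simplifier computes bottom-up, they become conditional rewrite rules. Together they
  expand and sort noncommutative polynomials in rectangular matrices.
\<close>

lemma assoc_mult_mat_dim: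
  fixes A :: "'a :: semiring_0 mat"
  assumes "dim_col A = dim_row B" and "dim_col B = dim_row C"
  shows "A * B * C = A * (B * C)"
  using assoc_mult_mat[of A "dim_row A" "dim_row B" B "dim_row C" C "dim_col C"] assms
  by (metis carrier_mat_triv)

lemma mult_add_mat_dim:
  fixes A :: "'a :: semiring_0 mat"
  assumes "dim_col A = dim_row B" and "dim_row B = dim_row C" and "dim_col B = dim_col C"
  shows "A * (B + C) = A * B + A * C"
  using mult_add_distrib_mat[of A "dim_row A" "dim_row B" B "dim_col C" C] assms
  by (metis carrier_mat_triv)

lemma add_mult_mat_dim:
  fixes A :: "'a :: semiring_0 mat"
  assumes "dim_col B = dim_row C" and "dim_row A = dim_row B" and "dim_col A = dim_col B"
  shows "(A + B) * C = A * C + B * C"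
  using add_mult_distrib_mat[of A "dim_row A" "dim_row C" B C "dim_col C"] assms
  by (metis carrier_mat_triv)

lemma add_commute_mat_dim:
  fixes A :: "'a :: comm_monoid_add mat"
  assumes "dim_row A = dim_row B" and "dim_col A = dim_col B"
  shows "A + B = B + A"
  using comm_add_mat[of A "dim_row B" "dim_col B" B] assms by (metis carrier_mat_triv)

lemma add_assoc_mat_dim:
  fixes A :: "'a :: comm_monoid_add mat"
  assumes "dim_row A = dim_row B" and "dim_col A = dim_col B"
    and "dim_row B = dim_row C" and "dim_col B = dim_col C"
  shows "A + B + C = A + (B + C)"
  using assms by (intro eq_matI) (auto simp: add.assoc)

lemma add_left_commute_mat_dim:
  fixes A :: "'a :: comm_monoid_add mat"
  assumes "dim_row A = dim_row B" and "dim_col A = dim_col B"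
    and "dim_row B = dim_row C" and "dim_col B = dim_col C"
  shows "A + (B + C) = B + (A + C)"
  using assms by (intro eq_matI) (auto simp: add.left_commute)

lemma diff_mat_dim:
  fixes A :: "'a :: ab_group_add mat"
  assumes "dim_row A = dim_row B" and "dim_col A = dim_col B"
  shows "A - B = A + - B"
  using assms by (intro eq_matI) auto

lemma mult_uminus_mat_dim:
  fixes A :: "'a :: comm_ring_1 mat"
  assumes "dim_col A = dim_row B"
  shows "A * (- B) = - (A * B)"
  using assms by simp

lemma uminus_mult_mat_dim:
  fixes A :: "'a :: comm_ring_1 mat"
  assumes "dim_col A = dim_row B"
  shows "(- A) * B = - (A * B)"
  using assms by simp

lemma uminus_add_mat_dim:
  fixes A :: "'a :: ab_group_add mat"
  assumes "dim_row A = dim_row B" and "dim_col A = dim_col B"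
  shows "- (A + B) = - A + - B"
  using assms by (intro eq_matI) auto

lemma cancel_mat_dim:
  fixes A :: "'a :: ab_group_add mat"
  shows "A + - A = 0\<^sub>m (dim_row A) (dim_col A)" "- A + A = 0\<^sub>m (dim_row A) (dim_col A)"
    "dim_row A = dim_row B \<Longrightarrow> dim_col A = dim_col B \<Longrightarrow> A + (- A + B) = B"
    "dim_row A = dim_row B \<Longrightarrow> dim_col A = dim_col B \<Longrightarrow> - A + (A + B) = B"
    "dim_row A = n \<Longrightarrow> dim_col A = m \<Longrightarrow> A + 0\<^sub>m n m = A"
    "dim_row A = n \<Longrightarrow> dim_col A = m \<Longrightarrow> 0\<^sub>m n m + A = A"
    "- (- A) = A" "- (0\<^sub>m n m) = (0\<^sub>m n m :: 'a mat)"
  by (auto intro!: eq_matI)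

lemma unit_mat_dim:
  fixes A :: "'a :: semiring_1 mat"
  shows "dim_row A = n \<Longrightarrow> 1\<^sub>m n * A = A" "dim_col A = n \<Longrightarrow> A * 1\<^sub>m n = A"
    "dim_row A = n \<Longrightarrow> 0\<^sub>m k n * A = 0\<^sub>m k (dim_col A)" "dim_col A = n \<Longrightarrow> A * 0\<^sub>m n k = 0\<^sub>m (dim_row A) k"
  by (metis carrier_mat_triv left_mult_one_mat right_mult_one_mat left_mult_zero_mat right_mult_zero_mat)+

lemmas mat_ring_simps =
  assoc_mult_mat_dim mult_add_mat_dim add_mult_mat_dim add_commute_mat_dim add_assoc_mat_dim
  add_left_commute_mat_dim diff_mat_dim mult_uminus_mat_dim uminus_mult_mat_dim
  uminus_add_mat_dim cancel_mat_dim unit_mat_dim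

text \<open>
  Products are kept nested to the right, so a relation \<^term>\<open>A * B = C\<close> must also
  be able to fire in front of a further factor.
\<close>

lemma mult_mat_cong_left:
  fixes A :: "'a :: semiring_0 mat"
  assumes "A * B = C" and "dim_col A = dim_row B" and "dim_col B = dim_row Z"
  shows "A * (B * Z) = C * Z"
  using assoc_mult_mat_dim[OF assms(2,3)] assms(1) by simp

lemma smult_mult_mat_dim:
  fixes A :: "'a :: comm_semiring_0 mat"
  assumes "dim_col A = dim_row B"
  shows "k \<cdot>\<^sub>m A * B = k \<cdot>\<^sub>m (A * B)" "A * (k \<cdot>\<^sub>m B) = k \<cdot>\<^sub>m (A * B)"
  using assms by (auto intro!: eq_matI simp: scalar_prod_def sum_distrib_left ac_simps)

lemma smult_add_mat_dim:
  fixes A :: "'a :: semiring_0 mat"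
  assumes "dim_row A = dim_row B" and "dim_col A = dim_col B"
  shows "k \<cdot>\<^sub>m (A + B) = k \<cdot>\<^sub>m A + k \<cdot>\<^sub>m B"
  using assms by (auto intro!: eq_matI simp: algebra_simps)

lemma smult_uminus_mat: "k \<cdot>\<^sub>m (- A) = - (k \<cdot>\<^sub>m (A :: 'a :: ring mat))"
  by (auto intro!: eq_matI)

lemma smult_smult_mat:
  fixes A :: "'a :: comm_ring_1 mat"
  shows "k \<cdot>\<^sub>m (l \<cdot>\<^sub>m A) = (k * l) \<cdot>\<^sub>m A"
  by (auto intro!: eq_matI simp: ac_simps)

lemma smult_mult_mat_vec_dim:
  fixes A :: "'a :: comm_semiring_0 mat"
  assumes "dim_col A = dim_vec v"
  shows "(c \<cdot>\<^sub>m A) *\<^sub>v v = c \<cdot>\<^sub>v (A *\<^sub>v v)"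
  using assms by (intro eq_vecI) (auto simp: scalar_prod_def sum_distrib_left ac_simps)

lemma mat_add_move:
  fixes M :: "'a :: ab_group_add mat"
  assumes "M + N = K" and "dim_row M = dim_row N" and "dim_col M = dim_col N"
  shows "M = K + - N"
  using assms(2,3) unfolding assms(1)[symmetric] by (intro eq_matI) auto

lemma mat_diff_eq_move:
  fixes M :: "'a :: ab_group_add mat"
  assumes "M + - N = K" and "dim_row M = dim_row N" and "dim_col M = dim_col N"
  shows "N = M + - K"
  using assms(2,3) unfolding assms(1)[symmetric] by (intro eq_matI) auto

section \<open>The conjugate transpose\<close>

lemma mat_adjoint_dim [simp]:
  "dim_row (mat_adjoint A) = dim_col A" "dim_col (mat_adjoint A) = dim_row A"
  unfolding mat_adjoint_def by auto

lemma mat_adjoint_carrier [simp]: "A \<in> carrier_mat n m \<Longrightarrow> mat_adjoint A \<in> carrier_mat m n"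
  by auto

lemma mat_adjoint_index [simp]:
  "i < dim_col A \<Longrightarrow> j < dim_row A \<Longrightarrow> mat_adjoint A $$ (i, j) = conjugate (A $$ (j, i))"
  unfolding mat_adjoint_def by (simp add: mat_of_rows_index)

lemma mat_adjoint_mult:
  fixes A :: "complex mat"
  assumes "dim_col A = dim_row B"
  shows "mat_adjoint (A * B) = mat_adjoint B * mat_adjoint A"
  using assms by (auto intro!: eq_matI simp: scalar_prod_def ac_simps)

lemma mat_adjoint_add:
  fixes A :: "complex mat"
  assumes "dim_row A = dim_row B" and "dim_col A = dim_col B"
  shows "mat_adjoint (A + B) = mat_adjoint A + mat_adjoint B"
  using assms by (auto intro!: eq_matI)

lemma mat_adjoint_diff:
  fixes A :: "complex mat"
  assumes "dim_row A = dim_row B" and "dim_col A = dim_col B"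
  shows "mat_adjoint (A - B) = mat_adjoint A - mat_adjoint B"
  using assms by (auto intro!: eq_matI)

lemma mat_adjoint_basic:
  fixes A :: "complex mat"
  shows "mat_adjoint (mat_adjoint A) = A" "mat_adjoint (1\<^sub>m n) = (1\<^sub>m n :: complex mat)"
    "mat_adjoint (0\<^sub>m n m) = (0\<^sub>m m n :: complex mat)" "mat_adjoint (- A) = - mat_adjoint A"
    "mat_adjoint (k \<cdot>\<^sub>m A) = cnj k \<cdot>\<^sub>m mat_adjoint A"
  by (auto intro!: eq_matI)

lemmas mat_adjoint_simps =
  mat_adjoint_mult mat_adjoint_add mat_adjoint_diff mat_adjoint_basic

lemma mat_adjoint_four_block:
  assumes "A \<in> carrier_mat nr1 nc1" "B \<in> carrier_mat nr1 nc2"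
    "C \<in> carrier_mat nr2 nc1" "D \<in> carrier_mat nr2 nc2"
  shows "mat_adjoint (four_block_mat A B C D) =
    four_block_mat (mat_adjoint A) (mat_adjoint C) (mat_adjoint B) (mat_adjoint D)"
  using assms by (auto intro!: eq_matI)

lemma adjoint_mult_vec_cscalar_prod:
  fixes A :: "complex mat"
  assumes "A \<in> carrier_mat n m" and "v \<in> carrier_vec m" and "w \<in> carrier_vec n"
  shows "(A *\<^sub>v v) \<bullet>c w = v \<bullet>c (mat_adjoint A *\<^sub>v w)"
proof -
  have "(A *\<^sub>v v) \<bullet>c w = (\<Sum>i<n. \<Sum>j<m. A $$ (i, j) * v $ j * cnj (w $ i))"
    using assms by (simp add: scalar_prod_def sum_distrib_right lessThan_atLeast0)
  also have "\<dots> = (\<Sum>j<m. \<Sum>i<n. A $$ (i, j) * v $ j * cnj (w $ i))"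
    by (rule sum.swap)
  also have "\<dots> = v \<bullet>c (mat_adjoint A *\<^sub>v w)"
    using assms by (simp add: scalar_prod_def sum_distrib_left lessThan_atLeast0 ac_simps)
  finally show ?thesis .
qed

lemma cscalar_prod_self_nonneg: "0 \<le> Re (v \<bullet>c (v :: complex vec))"
  by (auto simp: scalar_prod_def complex_mult_cnj intro!: add_nonneg_nonneg sum_nonneg)

lemma cscalar_prod_self_pos:
  assumes "v \<in> carrier_vec n" and "v \<noteq> 0\<^sub>v n"
  shows "0 < Re (v \<bullet>c (v :: complex vec))"
proof -
  have "v \<bullet>c v > 0" using assms by simp
  then show ?thesis by (simp add: less_complex_def)
qed

lemma pos_semidef_mult_adjoint:
  assumes "M \<in> carrier_mat n m" and "0 \<le> c"
  shows "pos_semidef n (complex_of_real c \<cdot>\<^sub>m (M * mat_adjoint M))"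
  unfolding pos_semidef_def hermitian_mat_def
proof (intro conjI ballI)
  show "complex_of_real c \<cdot>\<^sub>m (M * mat_adjoint M) \<in> carrier_mat n n"
    using assms by auto
  show "mat_adjoint (complex_of_real c \<cdot>\<^sub>m (M * mat_adjoint M)) = complex_of_real c \<cdot>\<^sub>m (M * mat_adjoint M)"
    using assms by (simp add: mat_adjoint_simps)
  fix v :: "complex vec" assume v: "v \<in> carrier_vec n"
  have "(complex_of_real c \<cdot>\<^sub>m (M * mat_adjoint M)) *\<^sub>v v
      = complex_of_real c \<cdot>\<^sub>v (M *\<^sub>v (mat_adjoint M *\<^sub>v v))"
    using assms v by (auto simp: assoc_mult_mat_vec[of M n m "mat_adjoint M" n v, symmetric])
  then have "((complex_of_real c \<cdot>\<^sub>m (M * mat_adjoint M)) *\<^sub>v v) \<bullet>c v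
      = c * ((mat_adjoint M *\<^sub>v v) \<bullet>c (mat_adjoint M *\<^sub>v v))"
    using assms v adjoint_mult_vec_cscalar_prod[of M n m "mat_adjoint M *\<^sub>v v" v]
    by (simp add: mult_mat_vec_carrier[of _ m n])
  then show "0 \<le> Re (((complex_of_real c \<cdot>\<^sub>m (M * mat_adjoint M)) *\<^sub>v v) \<bullet>c v)"
    using assms(2) cscalar_prod_self_nonneg[of "mat_adjoint M *\<^sub>v v"] by simp
qed

section \<open>Block matrices\<close>

lemma four_block_mat_inject:
  assumes "four_block_mat A B C D = four_block_mat A' B' C' D'"
    and "A \<in> carrier_mat r1 c1" "B \<in> carrier_mat r1 c2" "C \<in> carrier_mat r2 c1" "D \<in> carrier_mat r2 c2"
    and "A' \<in> carrier_mat r1 c1" "B' \<in> carrier_mat r1 c2" "C' \<in> carrier_mat r2 c1" "D' \<in> carrier_mat r2 c2"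
  shows "A = A'" "B = B'" "C = C'" "D = D'"
proof -
  note e = arg_cong[OF assms(1), of "\<lambda>M. M $$ (i, j)" for i j]
  show "A = A'"
  proof (rule eq_matI)
    fix i j assume "i < dim_row A'" "j < dim_col A'"
    then show "A $$ (i, j) = A' $$ (i, j)" using e[of i j] assms(2-) by auto
  qed (use assms in auto)
  show "B = B'"
  proof (rule eq_matI)
    fix i j assume "i < dim_row B'" "j < dim_col B'"
    then show "B $$ (i, j) = B' $$ (i, j)" using e[of i "c1 + j"] assms(2-) by auto
  qed (use assms in auto)
  show "C = C'"
  proof (rule eq_matI)
    fix i j assume "i < dim_row C'" "j < dim_col C'"
    then show "C $$ (i, j) = C' $$ (i, j)" using e[of "r1 + i" j] assms(2-) by auto
  qed (use assms in auto)
  show "D = D'"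
  proof (rule eq_matI)
    fix i j assume "i < dim_row D'" "j < dim_col D'"
    then show "D $$ (i, j) = D' $$ (i, j)" using e[of "r1 + i" "c1 + j"] assms(2-) by auto
  qed (use assms in auto)
qed

lemma four_block_mat_exhaust:
  assumes M: "M \<in> carrier_mat (r1 + r2) (c1 + c2)"
  obtains A B C D where "A \<in> carrier_mat r1 c1" "B \<in> carrier_mat r1 c2" "C \<in> carrier_mat r2 c1"
    "D \<in> carrier_mat r2 c2" "M = four_block_mat A B C D"
proof -
  obtain A B C D where "split_block M r1 c1 = (A, B, C, D)" by (metis prod_cases4)
  from split_block[OF this, of r2 c2] M that show ?thesis by auto
qed

lemma split_block_four_block:
  assumes "A \<in> carrier_mat r1 c1" "B \<in> carrier_mat r1 c2" "C \<in> carrier_mat r2 c1" "D \<in> carrier_mat r2 c2"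
  shows "split_block (four_block_mat A B C D) r1 c1 = (A, B, C, D)"
proof -
  obtain A' B' C' D' where s: "split_block (four_block_mat A B C D) r1 c1 = (A', B', C', D')"
    by (metis prod_cases4)
  note b = split_block[OF s, of r2 c2]
  have dims: "dim_row (four_block_mat A B C D) = r1 + r2" "dim_col (four_block_mat A B C D) = c1 + c2"
    using assms by auto
  from four_block_mat_inject[OF b(5)[OF dims] assms b(1-4)[OF dims]] show ?thesis unfolding s by simp
qed

lemma stacked_dim [simp]:
  "dim_row (A @\<^sub>r B) = dim_row A + dim_row B" "dim_col (A @\<^sub>r B) = dim_col A"
  "dim_row (append_cols A B) = dim_row A" "dim_col (append_cols A B) = dim_col A + dim_col B"
  by (simp_all add: append_rows_def append_cols_def)

lemma append_cols_carrier [simp]: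
  "A \<in> carrier_mat n c1 \<Longrightarrow> B \<in> carrier_mat n c2 \<Longrightarrow> append_cols A B \<in> carrier_mat n (c1 + c2)"
  by (auto simp: append_cols_def)

lemma append_cols_four_block:
  "A \<in> carrier_mat n c1 \<Longrightarrow> B \<in> carrier_mat n c2 \<Longrightarrow>
    append_cols A B = four_block_mat A B (0\<^sub>m 0 c1) (0\<^sub>m 0 c2)"
  by (simp add: append_cols_def)

lemma append_rows_four_block:
  "A \<in> carrier_mat r1 m \<Longrightarrow> B \<in> carrier_mat r2 m \<Longrightarrow>
    A @\<^sub>r B = four_block_mat A (0\<^sub>m r1 0) B (0\<^sub>m r2 0)"
  by (simp add: append_rows_def)

lemma append_cols_inject:
  assumes "append_cols A B = append_cols A' B'"
    and "A \<in> carrier_mat n c1" "B \<in> carrier_mat n c2" "A' \<in> carrier_mat n c1" "B' \<in> carrier_mat n c2"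
  shows "A = A'" "B = B'"
  using four_block_mat_inject[of A B "0\<^sub>m 0 c1" "0\<^sub>m 0 c2" A' B' "0\<^sub>m 0 c1" "0\<^sub>m 0 c2" n c1 c2 0] assms
  by (auto simp: append_cols_four_block)

lemma append_rows_inject:
  assumes "A @\<^sub>r B = A' @\<^sub>r B'"
    and "A \<in> carrier_mat r1 m" "B \<in> carrier_mat r2 m" "A' \<in> carrier_mat r1 m" "B' \<in> carrier_mat r2 m"
  shows "A = A'" "B = B'"
  using four_block_mat_inject[of A "0\<^sub>m r1 0" B "0\<^sub>m r2 0" A' "0\<^sub>m r1 0" B' "0\<^sub>m r2 0" r1 m 0 r2] assms
  by (auto simp: append_rows_four_block)

lemma four_block_mat_zero_dim:
  fixes A :: "'a :: zero mat"
  shows "A \<in> carrier_mat r1 c1 \<Longrightarrow> B \<in> carrier_mat r1 0 \<Longrightarrow> C \<in> carrier_mat 0 c1 \<Longrightarrow> D \<in> carrier_mat 0 0 \<Longrightarrow>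
    four_block_mat A B C D = A"
  by (auto intro!: eq_matI)

lemma append_cols_mult_append_rows:
  fixes U :: "'a :: comm_ring_1 mat"
  assumes "U \<in> carrier_mat p d" "V \<in> carrier_mat p m" "X \<in> carrier_mat d q" "Y \<in> carrier_mat m q"
  shows "append_cols U V * (X @\<^sub>r Y) = U * X + V * Y"
proof -
  have "append_cols U V * (X @\<^sub>r Y) = four_block_mat (U * X + V * Y) (U * 0\<^sub>m d 0 + V * 0\<^sub>m m 0)
      (0\<^sub>m 0 d * X + 0\<^sub>m 0 m * Y) (0\<^sub>m 0 d * 0\<^sub>m d 0 + 0\<^sub>m 0 m * 0\<^sub>m m 0)"
    unfolding append_cols_four_block[OF assms(1,2)] append_rows_four_block[OF assms(3,4)]
    using assms by (intro mult_four_block_mat) auto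
  then show ?thesis using assms by (simp add: four_block_mat_zero_dim[of _ p q])
qed

lemma append_rows_mult_append_cols:
  fixes U :: "'a :: comm_ring_1 mat"
  assumes "U \<in> carrier_mat p d" "V \<in> carrier_mat q d" "Y \<in> carrier_mat d r" "Z \<in> carrier_mat d s"
  shows "(U @\<^sub>r V) * append_cols Y Z = four_block_mat (U * Y) (U * Z) (V * Y) (V * Z)"
proof -
  have "(U @\<^sub>r V) * append_cols Y Z = four_block_mat
      (U * Y + 0\<^sub>m p 0 * 0\<^sub>m 0 r) (U * Z + 0\<^sub>m p 0 * 0\<^sub>m 0 s)
      (V * Y + 0\<^sub>m q 0 * 0\<^sub>m 0 r) (V * Z + 0\<^sub>m q 0 * 0\<^sub>m 0 s)"
    unfolding append_cols_four_block[OF assms(3,4)] append_rows_four_block[OF assms(1,2)]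
    using assms by (intro mult_four_block_mat) auto
  then show ?thesis using assms by simp
qed

lemma append_rows_mult_mat:
  fixes U :: "'a :: comm_ring_1 mat"
  assumes "U \<in> carrier_mat p d" "V \<in> carrier_mat q d" "M \<in> carrier_mat d r"
  shows "(U @\<^sub>r V) * M = (U * M) @\<^sub>r (V * M)"
proof -
  have "M = append_cols M (0\<^sub>m d 0)" using assms by (auto intro!: eq_matI simp: append_cols_def)
  then have "(U @\<^sub>r V) * M = four_block_mat (U * M) (U * 0\<^sub>m d 0) (V * M) (V * 0\<^sub>m d 0)"
    using append_rows_mult_append_cols[OF assms zero_carrier_mat] by metis
  then show ?thesis using assms by (simp add: append_rows_four_block[of _ p r _ q])
qed

lemma mat_mult_append_cols:
  fixes Y :: "'a :: comm_ring_1 mat"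
  assumes "M \<in> carrier_mat r d" "Y \<in> carrier_mat d m" "Z \<in> carrier_mat d k"
  shows "M * append_cols Y Z = append_cols (M * Y) (M * Z)"
proof -
  have "M = M @\<^sub>r (0\<^sub>m 0 d)" using assms by (auto intro!: eq_matI simp: append_rows_def)
  then have "M * append_cols Y Z = four_block_mat (M * Y) (M * Z) (0\<^sub>m 0 d * Y) (0\<^sub>m 0 d * Z)"
    using append_rows_mult_append_cols[OF assms(1) zero_carrier_mat assms(2,3)] by metis
  then show ?thesis using assms by (simp add: append_cols_four_block[of _ r m _ k])
qed

lemma four_block_mult_append_rows:
  fixes A :: "'a :: comm_ring_1 mat"
  assumes "A \<in> carrier_mat r1 c1" "B \<in> carrier_mat r1 c2" "C \<in> carrier_mat r2 c1" "D \<in> carrier_mat r2 c2"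
    and "X \<in> carrier_mat c1 m" "Y \<in> carrier_mat c2 m"
  shows "four_block_mat A B C D * (X @\<^sub>r Y) = (A * X + B * Y) @\<^sub>r (C * X + D * Y)"
proof -
  have "four_block_mat A B C D * (X @\<^sub>r Y) = four_block_mat (A * X + B * Y) (A * 0\<^sub>m c1 0 + B * 0\<^sub>m c2 0)
      (C * X + D * Y) (C * 0\<^sub>m c1 0 + D * 0\<^sub>m c2 0)"
    unfolding append_rows_four_block[OF assms(5,6)] using assms by (intro mult_four_block_mat) auto
  then show ?thesis using assms by (simp add: append_rows_four_block[of _ r1 m _ r2])
qed

lemma append_cols_mult_four_block:
  fixes A :: "'a :: comm_ring_1 mat"
  assumes "A \<in> carrier_mat r1 c1" "B \<in> carrier_mat r1 c2" "C \<in> carrier_mat r2 c1" "D \<in> carrier_mat r2 c2"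
    and "U \<in> carrier_mat m r1" "V \<in> carrier_mat m r2"
  shows "append_cols U V * four_block_mat A B C D = append_cols (U * A + V * C) (U * B + V * D)"
proof -
  have "append_cols U V * four_block_mat A B C D = four_block_mat (U * A + V * C) (U * B + V * D)
      (0\<^sub>m 0 r1 * A + 0\<^sub>m 0 r2 * C) (0\<^sub>m 0 r1 * B + 0\<^sub>m 0 r2 * D)"
    unfolding append_cols_four_block[OF assms(5,6)] using assms by (intro mult_four_block_mat) auto
  then show ?thesis using assms by (simp add: append_cols_four_block[of _ m c1 _ c2])
qed

lemma append_rows_add:
  fixes A :: "'a :: comm_ring_1 mat"
  assumes "A \<in> carrier_mat r1 m" "B \<in> carrier_mat r2 m" "A' \<in> carrier_mat r1 m" "B' \<in> carrier_mat r2 m"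
  shows "(A @\<^sub>r B) + (A' @\<^sub>r B') = (A + A') @\<^sub>r (B + B')"
  using assms by (auto intro!: eq_matI simp: append_rows_def)

lemma append_rows_zero: "0\<^sub>m r1 m @\<^sub>r 0\<^sub>m r2 m = 0\<^sub>m (r1 + r2) m"
  by (auto intro!: eq_matI simp: append_rows_def)

lemma mat_adjoint_append_rows:
  assumes "A \<in> carrier_mat r1 m" "B \<in> carrier_mat r2 m"
  shows "mat_adjoint (A @\<^sub>r B) = append_cols (mat_adjoint A) (mat_adjoint (B :: complex mat))"
  using assms by (auto intro!: eq_matI simp: append_rows_def append_cols_def)

lemma mat_adjoint_append_cols:
  assumes "A \<in> carrier_mat n c1" "B \<in> carrier_mat n c2"
  shows "mat_adjoint (append_cols A B) = mat_adjoint A @\<^sub>r mat_adjoint (B :: complex mat)"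
  using assms by (auto intro!: eq_matI simp: append_rows_def append_cols_def)

lemma map_mat_append_rows:
  "f 0 = 0 \<Longrightarrow> A \<in> carrier_mat r1 m \<Longrightarrow> B \<in> carrier_mat r2 m \<Longrightarrow>
    map_mat f (A @\<^sub>r B) = map_mat f A @\<^sub>r map_mat f B"
  by (auto intro!: eq_matI simp: append_rows_def)

lemma map_mat_append_cols:
  "f 0 = 0 \<Longrightarrow> A \<in> carrier_mat n c1 \<Longrightarrow> B \<in> carrier_mat n c2 \<Longrightarrow>
    map_mat f (append_cols A B) = append_cols (map_mat f A) (map_mat f B)"
  by (auto intro!: eq_matI simp: append_cols_def)

text \<open>
  Realization matrices list the outputs first and then the states. The same 3 by 3 matrix is read
  in two ways: with the first \<^term>\<open>d\<close> states grouped with the remaining states,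
  as in a realization, or with the outputs, as in the recursion.
\<close>

lemma four_block_repartition:
  assumes "Dt \<in> carrier_mat p p" "U \<in> carrier_mat p d" "Ch \<in> carrier_mat p m"
    "b \<in> carrier_mat d p" "W \<in> carrier_mat d d" "N \<in> carrier_mat d m"
    "B \<in> carrier_mat m p" "A \<in> carrier_mat m m"
  shows "four_block_mat Dt (append_cols U Ch) (b @\<^sub>r B) (four_block_mat W N (0\<^sub>m m d) A)
    = four_block_mat (four_block_mat Dt U b W) (Ch @\<^sub>r N) (append_cols B (0\<^sub>m m d)) A"
    (is "?L = ?R")
proof (rule eq_matI)
  note dims = assms[THEN carrier_matD(1)] assms[THEN carrier_matD(2)]
  fix i j assume "i < dim_row ?R" "j < dim_col ?R"
  then have "i < p + d + m" "j < p + d + m" by (simp_all add: dims)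
  then show "?L $$ (i, j) = ?R $$ (i, j)"
    by (cases "i < p"; cases "i < p + d"; cases "j < p"; cases "j < p + d";
        simp add: append_cols_def append_rows_def dims; arith)
qed (use assms in \<open>simp_all add: append_cols_def append_rows_def\<close>)

section \<open>Inverses and the square root of the identity\<close>

lemma mat_inv_eqI:
  assumes M: "M \<in> carrier_mat n n" and N: "N \<in> carrier_mat n n" and MN: "M * N = 1\<^sub>m n"
  shows "mat_inv M = N"
proof -
  have NM: "N * M = 1\<^sub>m n" by (rule mat_mult_left_right_inverse[OF M N MN])
  have "M \<in> Units (ring_mat TYPE('a) n undefined)"
    using M N MN NM unfolding Units_def by (auto simp: ring_mat_simps)
  then obtain B where B: "mat_inverse M = Some B"
    using mat_inverse(1)[OF M, of undefined] by fastforce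
  from mat_inverse(2)[OF M B] have "M * B = 1\<^sub>m n" and Bc: "B \<in> carrier_mat n n" by auto
  then have "N * (M * B) = N" using N by simp
  then have "B = N" using assoc_mult_mat[OF N M Bc] NM Bc by simp
  then show ?thesis by (simp add: mat_inv_def B)
qed

lemma mat_inv_det:
  assumes M: "M \<in> carrier_mat n n" and "det M \<noteq> 0"
  shows "mat_inv M \<in> carrier_mat n n" "M * mat_inv M = 1\<^sub>m n" "mat_inv M * M = 1\<^sub>m n"
proof -
  have "M \<in> Units (ring_mat TYPE('a) n undefined)"
    using det_non_zero_imp_unit[OF assms] .
  then obtain B where B: "mat_inverse M = Some B"
    using mat_inverse(1)[OF M, of undefined] by fastforce
  from mat_inverse(2)[OF M B] show "mat_inv M \<in> carrier_mat n n" "M * mat_inv M = 1\<^sub>m n" "mat_inv M * M = 1\<^sub>m n"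
    by (auto simp: mat_inv_def B)
qed

lemma mat_inv_one: "mat_inv (1\<^sub>m n) = 1\<^sub>m n"
  by (rule mat_inv_eqI[of _ n]) auto

lemma pos_def_one: "pos_def n (1\<^sub>m n)"
  unfolding pos_def_def hermitian_mat_def
  by (auto simp: mat_adjoint_simps cscalar_prod_self_pos)

text \<open>
  If \<open>S\<^sup>2 = I\<close> then \<open>w = S v - v\<close> satisfies \<open>S w = -
  w\<close>, and positivity of \<open>S\<close> forces \<open>w = 0\<close>.
\<close>

lemma mat_sqrt_one: "mat_sqrt (1\<^sub>m n) = 1\<^sub>m n"
  unfolding mat_sqrt_def
proof (rule the_equality)
  show "pos_def (dim_row (1\<^sub>m n :: complex mat)) (1\<^sub>m n) \<and> 1\<^sub>m n * 1\<^sub>m n = (1\<^sub>m n :: complex mat)"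
    by (simp add: pos_def_one)
next
  fix S :: "complex mat"
  assume "pos_def (dim_row (1\<^sub>m n :: complex mat)) S \<and> S * S = 1\<^sub>m n"
  then have S: "S \<in> carrier_mat n n" and SS: "S * S = 1\<^sub>m n"
    and pos: "\<And>v. v \<in> carrier_vec n \<Longrightarrow> v \<noteq> 0\<^sub>v n \<Longrightarrow> 0 < Re ((S *\<^sub>v v) \<bullet>c v)"
    unfolding pos_def_def by auto
  have "S *\<^sub>v v = 1\<^sub>m n *\<^sub>v v" if v: "v \<in> carrier_vec n" for v
  proof -
    define w where "w = S *\<^sub>v v - v"
    have w: "w \<in> carrier_vec n" using S v by (auto simp: w_def)
    have "S *\<^sub>v w = S * S *\<^sub>v v - S *\<^sub>v v"
      using S v by (auto simp: w_def mult_minus_distrib_mat_vec[of S n n] assoc_mult_mat_vec[of S n n S n])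
    also have "\<dots> = - w" using S v by (auto simp: SS w_def)
    finally have "S *\<^sub>v w = - w" .
    then have "Re ((S *\<^sub>v w) \<bullet>c w) = - Re (w \<bullet>c w)" using w by simp
    then have "w = 0\<^sub>v n"
      using pos[OF w] cscalar_prod_self_nonneg[of w] by fastforce
    have "S *\<^sub>v v = w + v" using S v by (intro eq_vecI) (auto simp: w_def)
    then show ?thesis using v \<open>w = 0\<^sub>v n\<close> by simp
  qed
  then have fixed: "S *\<^sub>v unit_vec n j = unit_vec n j" for j by simp
  show "S = 1\<^sub>m n"
  proof (intro eq_matI)
    fix i j assume "i < dim_row (1\<^sub>m n :: complex mat)" "j < dim_col (1\<^sub>m n :: complex mat)"
    then show "S $$ (i, j) = 1\<^sub>m n $$ (i, j)"
      using S arg_cong[OF fixed[of j], of "\<lambda>v. v $ i"] by simp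
  qed (use S in auto)
qed

section \<open>Resolvents and realizations\<close>

lemma (in comm_ring_hom) map_mat_dim:
  "dim_col A = dim_row B \<Longrightarrow> map_mat hom (A * B) = map_mat hom A * map_mat hom B"
  "dim_row A = dim_row B \<Longrightarrow> dim_col A = dim_col B \<Longrightarrow> map_mat hom (A + B) = map_mat hom A + map_mat hom B"
  "dim_row A = dim_row B \<Longrightarrow> dim_col A = dim_col B \<Longrightarrow> map_mat hom (A - B) = map_mat hom A - map_mat hom B"
  "map_mat hom (- A) = - map_mat hom A"
  "map_mat hom (k \<cdot>\<^sub>m A) = hom k \<cdot>\<^sub>m map_mat hom A"
  "map_mat hom (1\<^sub>m n) = 1\<^sub>m n"
  "map_mat hom (0\<^sub>m n m) = 0\<^sub>m n m"
  by (auto intro!: eq_matI simp: hom_distribs scalar_prod_def)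

lemma comm_ring_hom_to_fract: "comm_ring_hom (to_fract :: 'a :: idom \<Rightarrow> 'a fract)"
  by unfold_locales auto

lemma comm_ring_hom_poly_eval: "comm_ring_hom (\<lambda>p :: 'a :: comm_ring_1 poly. poly p z)"
  by unfold_locales auto

lemma rf_const_to_fract: "rf_const c = to_fract [:c:]"
  by (simp add: rf_const_def to_fract_def)

lemma comm_ring_hom_rf_const: "comm_ring_hom rf_const"
  by unfold_locales
    (simp_all add: rf_const_to_fract flip: to_fract_add to_fract_mult one_pCons)

lemma rf_const_0: "rf_const 0 = 0"
  by (simp add: rf_const_to_fract flip: one_pCons)

lemmas const_mat_simps = comm_ring_hom.map_mat_dim[OF comm_ring_hom_rf_const]

definition pencil :: "nat \<Rightarrow> complex mat \<Rightarrow> complex poly fract mat" where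
  "pencil n A = rf_var \<cdot>\<^sub>m 1\<^sub>m n - const_mat A"

definition resolvent :: "nat \<Rightarrow> complex mat \<Rightarrow> complex poly fract mat" where
  "resolvent n A = mat_inv (pencil n A)"

lemma pencil_carrier [simp]: "A \<in> carrier_mat n n \<Longrightarrow> pencil n A \<in> carrier_mat n n"
  by (auto simp: pencil_def)

lemma char_poly_matrix_dim [simp]:
  "dim_row (char_poly_matrix A) = dim_row A" "dim_col (char_poly_matrix A) = dim_col A"
  by (simp_all add: char_poly_matrix_def)

lemma pencil_dim [simp]: "dim_row (pencil n A) = dim_row A" "dim_col (pencil n A) = dim_col A"
  by (simp_all add: pencil_def)

lemma pencil_char_poly_matrix:
  assumes "A \<in> carrier_mat n n"
  shows "pencil n A = map_mat to_fract (char_poly_matrix A)"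
proof -
  interpret comm_ring_hom "to_fract :: complex poly \<Rightarrow> _" by (rule comm_ring_hom_to_fract)
  have "rf_const c = - to_fract [:- c:]" for c
    by (simp add: rf_const_to_fract flip: hom_uminus)
  moreover have "rf_var + to_fract [:- c:] = to_fract [:- c, 1:]" for c
    by (simp add: rf_var_def flip: to_fract_def hom_add)
  ultimately show ?thesis
    using assms by (auto intro!: eq_matI simp: pencil_def char_poly_matrix_def one_pCons)
qed

lemma char_poly_nonzero: "A \<in> carrier_mat n n \<Longrightarrow> char_poly A \<noteq> 0"
  using degree_monic_char_poly[of A n] by auto

text \<open>
  Cramer's rule exhibits the resolvent as a polynomial matrix over the characteristic polynomial.
  It shows at once that the resolvent exists, since the characteristic polynomial is monic, and
  that its poles are eigenvalues.
\<close>

lemma resolvent_adj_mat: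
  assumes A: "A \<in> carrier_mat n n"
  shows "resolvent n A
    = (1 / to_fract (char_poly A)) \<cdot>\<^sub>m map_mat to_fract (adj_mat (char_poly_matrix A))"
proof -
  interpret comm_ring_hom "to_fract :: complex poly \<Rightarrow> _" by (rule comm_ring_hom_to_fract)
  let ?N = "adj_mat (char_poly_matrix A)"
  have N: "?N \<in> carrier_mat n n" "char_poly_matrix A * ?N = char_poly A \<cdot>\<^sub>m 1\<^sub>m n"
    using adj_mat[of "char_poly_matrix A" n] A by (auto simp: char_poly_def)
  have nz: "to_fract (char_poly A) \<noteq> 0" using char_poly_nonzero[OF A] by simp
  have "pencil n A * ((1 / to_fract (char_poly A)) \<cdot>\<^sub>m map_mat to_fract ?N)
      = (1 / to_fract (char_poly A)) \<cdot>\<^sub>m map_mat to_fract (char_poly_matrix A * ?N)"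
    using A N(1) by (simp add: pencil_char_poly_matrix smult_mult_mat_dim map_mat_dim)
  also have "\<dots> = 1\<^sub>m n"
    using nz by (auto simp: N(2) map_mat_dim intro!: eq_matI)
  finally show ?thesis
    unfolding resolvent_def using A N(1) by (intro mat_inv_eqI) auto
qed

lemma resolvent:
  assumes A: "A \<in> carrier_mat n n"
  shows "resolvent n A \<in> carrier_mat n n" "pencil n A * resolvent n A = 1\<^sub>m n"
    "resolvent n A * pencil n A = 1\<^sub>m n"
proof -
  interpret inj_idom_hom "to_fract :: complex poly \<Rightarrow> _"
    by unfold_locales auto
  have "det (pencil n A) = to_fract (char_poly A)"
    using A by (simp add: pencil_char_poly_matrix char_poly_def hom_det)
  then have "det (pencil n A) \<noteq> 0" using char_poly_nonzero[OF A] by simp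
  from mat_inv_det[OF pencil_carrier[OF A] this]
  show "resolvent n A \<in> carrier_mat n n" "pencil n A * resolvent n A = 1\<^sub>m n"
    "resolvent n A * pencil n A = 1\<^sub>m n" by (auto simp: resolvent_def)
qed

lemma resolvent_dim [simp]:
  assumes "A \<in> carrier_mat n n"
  shows "dim_row (resolvent n A) = n" "dim_col (resolvent n A) = n"
  using resolvent(1)[OF assms] by auto

lemma realization_iff_resolvent:
  "realization p n A B C D G \<longleftrightarrow>
     A \<in> carrier_mat n n \<and> B \<in> carrier_mat n p \<and> C \<in> carrier_mat p n \<and> D \<in> carrier_mat p p \<and>
     G = const_mat D + const_mat C * resolvent n A * const_mat B"
  unfolding realization_def resolvent_def pencil_def ..

lemma resolvent_triangular:
  assumes W: "W \<in> carrier_mat d d" and N: "N \<in> carrier_mat d m" and A: "A \<in> carrier_mat m m"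
  shows "resolvent (d + m) (four_block_mat W N (0\<^sub>m m d) A) =
    four_block_mat (resolvent d W) (resolvent d W * const_mat N * resolvent m A)
      (0\<^sub>m m d) (resolvent m A)" (is "_ = ?R")
proof -
  interpret comm_ring_hom rf_const by (rule comm_ring_hom_rf_const)
  note W' = resolvent[OF W] and A' = resolvent[OF A]
  have R: "?R \<in> carrier_mat (d + m) (d + m)" using W' A' N by auto
  have P: "pencil (d + m) (four_block_mat W N (0\<^sub>m m d) A)
      = four_block_mat (pencil d W) (- const_mat N) (0\<^sub>m m d) (pencil m A)"
    using W N A by (auto intro!: eq_matI simp: pencil_def)
  have 1: "pencil d W * (resolvent d W * const_mat N * resolvent m A) = const_mat N * resolvent m A"
    using W N A W'(1) A'(1) by (simp add: mat_ring_simps mult_mat_cong_left[OF W'(2)])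
  have "pencil (d + m) (four_block_mat W N (0\<^sub>m m d) A) * ?R
     = four_block_mat (pencil d W * resolvent d W + (- const_mat N) * 0\<^sub>m m d)
        (pencil d W * (resolvent d W * const_mat N * resolvent m A) + (- const_mat N) * resolvent m A)
        (0\<^sub>m m d * resolvent d W + pencil m A * 0\<^sub>m m d)
        (0\<^sub>m m d * (resolvent d W * const_mat N * resolvent m A) + pencil m A * resolvent m A)"
    unfolding P using W N A W' A'
    by (intro mult_four_block_mat[of _ d d _ m _ m]) auto
  also have "\<dots> = four_block_mat (1\<^sub>m d) (0\<^sub>m d m) (0\<^sub>m m d) (1\<^sub>m m)"
    unfolding 1 using W N A W' A' pencil_carrier[OF A]
    by (intro cong_four_block_mat) (auto simp: mat_ring_simps)
  also have "\<dots> = 1\<^sub>m (d + m)" by simp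
  finally show ?thesis
    unfolding resolvent_def[of "d + m"] using W N A R by (intro mat_inv_eqI[of _ "d + m"]) auto
qed

text \<open>
  Inverting the block triangular pencil gives the transfer function of a cascade: the term through
  \<open>N\<close> is the signal that passes through both groups of states. It serves twice: for
  the factorization itself, and with \<open>U = 0\<close> to delete states that are invisible at
  the output.
\<close>

lemma realization_triangular:
  assumes G: "realization p (d + m) (four_block_mat W N (0\<^sub>m m d) A) (b @\<^sub>r B) (append_cols U C) D G"
    and W: "W \<in> carrier_mat d d" and N: "N \<in> carrier_mat d m" and A: "A \<in> carrier_mat m m"
    and b: "b \<in> carrier_mat d p" and B: "B \<in> carrier_mat m p"
    and U: "U \<in> carrier_mat p d" and C: "C \<in> carrier_mat p m"
  shows "G = const_mat D + (const_mat U * (resolvent d W * const_mat b)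
    + (const_mat U * (resolvent d W * (const_mat N * (resolvent m A * const_mat B)))
    + const_mat C * (resolvent m A * const_mat B)))"
proof -
  note W' = resolvent(1)[OF W] and A' = resolvent(1)[OF A]
  let ?R12 = "resolvent d W * const_mat N * resolvent m A"
  have D: "D \<in> carrier_mat p p" and GD: "G = const_mat D + const_mat (append_cols U C)
      * four_block_mat (resolvent d W) ?R12 (0\<^sub>m m d) (resolvent m A) * const_mat (b @\<^sub>r B)"
    using G by (auto simp: realization_iff_resolvent resolvent_triangular[OF W N A])
  have append: "const_mat (append_cols U C) = append_cols (const_mat U) (const_mat C)"
    "const_mat (b @\<^sub>r B) = const_mat b @\<^sub>r const_mat B"
    using U C b B by (simp_all add: map_mat_append_cols[of _ _ p d _ m] map_mat_append_rows[of _ _ d p _ m] rf_const_0)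
  have "append_cols (const_mat U) (const_mat C)
      * four_block_mat (resolvent d W) ?R12 (0\<^sub>m m d) (resolvent m A)
    = append_cols (const_mat U * resolvent d W + const_mat C * 0\<^sub>m m d)
        (const_mat U * ?R12 + const_mat C * resolvent m A)"
    using W N A W' A' U C by (intro append_cols_mult_four_block[of _ d d _ m _ m _ _ p]) auto
  moreover have "\<dots> * (const_mat b @\<^sub>r const_mat B)
    = (const_mat U * resolvent d W + const_mat C * 0\<^sub>m m d) * const_mat b
      + (const_mat U * ?R12 + const_mat C * resolvent m A) * const_mat B"
    using W N A W' A' U C b B by (intro append_cols_mult_append_rows[of _ p d _ m _ p]) auto
  ultimately show ?thesis
    unfolding GD append using W N A W' A' U C b B D by (simp add: mat_ring_simps)
qed

lemma realization_similar:
  assumes G: "realization p n A B C D G" and sim: "similar_mat_wit A A' P Q"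
  shows "realization p n A' (Q * B) (C * P) D G"
proof -
  have c: "A \<in> carrier_mat n n" "B \<in> carrier_mat n p" "C \<in> carrier_mat p n" "D \<in> carrier_mat p p"
    and GD: "G = const_mat D + const_mat C * resolvent n A * const_mat B"
    using G by (auto simp: realization_iff_resolvent)
  note s = similar_mat_witD2[OF c(1) sim]
  note R = resolvent[OF s(5)]
  have Pe: "pencil n A = const_mat P * pencil n A' * const_mat Q"
  proof -
    have "const_mat P * const_mat Q = 1\<^sub>m n"
      using s by (simp flip: const_mat_simps)
    then show ?thesis
      using s(5-7) unfolding pencil_def s(3)
      by (simp add: const_mat_simps mat_ring_simps smult_mult_mat_dim)
  qed
  have QP: "const_mat Q * const_mat P = 1\<^sub>m n" "const_mat P * const_mat Q = 1\<^sub>m n"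
    using s by (simp_all flip: const_mat_simps)
  have "resolvent n A = const_mat P * resolvent n A' * const_mat Q"
    unfolding resolvent_def[of n A]
  proof (rule mat_inv_eqI[of _ n])
    show "pencil n A * (const_mat P * resolvent n A' * const_mat Q) = 1\<^sub>m n"
      using s(5-7) R(1) pencil_carrier[OF s(5)] unfolding Pe
      by (simp add: mat_ring_simps mult_mat_cong_left[OF QP(1)] QP mult_mat_cong_left[OF R(2)])
  qed (use c s R in auto)
  then show ?thesis
    using c s(5-7) R(1) unfolding realization_iff_resolvent GD
    by (simp add: mat_ring_simps const_mat_simps)
qed

section \<open>Values of rational matrix functions\<close>

text \<open>
  Reduction to lowest terms only cancels factors of the denominator, so a representation whose
  denominator does not vanish at \<open>z\<close> may be evaluated directly.
\<close>

lemma rf_eval_Fract: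
  assumes b: "poly b z \<noteq> 0"
  shows "\<not> rf_pole (Fraction_Field.Fract a b) z" "rf_eval (Fraction_Field.Fract a b) z = poly a z / poly b z"
proof -
  define f where "f = Fraction_Field.Fract a b"
  obtain a' b' where q: "quot_of_fract f = (a', b')" by force
  have b': "b' \<noteq> 0" using snd_quot_of_fract_nonzero[of f] by (simp add: q)
  have "b \<noteq> 0" using b by auto
  have "Fraction_Field.Fract a' b' = Fraction_Field.Fract a b"
    using Fract_quot_of_fract[of f] unfolding q by (simp add: f_def)
  then have eq: "a' * b = a * b'" using b' \<open>b \<noteq> 0\<close> by (simp add: eq_fract)
  have "coprime a' b'" using coprime_quot_of_fract[of f] by (simp add: q)
  moreover have "b' dvd a' * b" by (simp add: eq)
  ultimately have "b' dvd b" by (simp add: coprime_dvd_mult_right_iff coprime_commute)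
  then have nz: "poly b' z \<noteq> 0" using b by (auto simp: dvd_def)
  then show "\<not> rf_pole (Fraction_Field.Fract a b) z" by (simp add: rf_pole_def q flip: f_def)
  have "poly a' z * poly b z = poly a z * poly b' z"
    using arg_cong[OF eq, of "\<lambda>p. poly p z"] by simp
  then show "rf_eval (Fraction_Field.Fract a b) z = poly a z / poly b z"
    using nz b by (simp add: rf_eval_def q frac_eq_eq flip: f_def)
qed

lemma shifted_inverse:
  assumes A: "A \<in> carrier_mat n n" and z: "\<not> eigenvalue A (z :: complex)"
  shows "mat_inv (z \<cdot>\<^sub>m 1\<^sub>m n - A) \<in> carrier_mat n n"
    "(z \<cdot>\<^sub>m 1\<^sub>m n - A) * mat_inv (z \<cdot>\<^sub>m 1\<^sub>m n - A) = 1\<^sub>m n"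
    "mat_inv (z \<cdot>\<^sub>m 1\<^sub>m n - A) * (z \<cdot>\<^sub>m 1\<^sub>m n - A) = 1\<^sub>m n"
    "mat_inv (z \<cdot>\<^sub>m 1\<^sub>m n - A) =
       (1 / poly (char_poly A) z) \<cdot>\<^sub>m map_mat (\<lambda>q. poly q z) (adj_mat (char_poly_matrix A))"
proof -
  note map_mat_dim = comm_ring_hom.map_mat_dim[OF comm_ring_hom_poly_eval]
  have e: "z \<cdot>\<^sub>m 1\<^sub>m n - A = map_mat (\<lambda>q. poly q z) (char_poly_matrix A)"
    using A by (auto intro!: eq_matI simp: char_poly_matrix_def)
  have nz: "poly (char_poly A) z \<noteq> 0" using eigenvalue_root_char_poly[OF A] z by simp
  have cm: "z \<cdot>\<^sub>m 1\<^sub>m n - A \<in> carrier_mat n n" using A by auto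
  have "det (z \<cdot>\<^sub>m 1\<^sub>m n - A) \<noteq> 0" using nz unfolding e by (simp add: char_poly_def comm_ring_hom.hom_det[OF comm_ring_hom_poly_eval])
  from mat_inv_det[OF cm this] show
    "mat_inv (z \<cdot>\<^sub>m 1\<^sub>m n - A) \<in> carrier_mat n n"
    "(z \<cdot>\<^sub>m 1\<^sub>m n - A) * mat_inv (z \<cdot>\<^sub>m 1\<^sub>m n - A) = 1\<^sub>m n"
    "mat_inv (z \<cdot>\<^sub>m 1\<^sub>m n - A) * (z \<cdot>\<^sub>m 1\<^sub>m n - A) = 1\<^sub>m n" by auto
  let ?N = "adj_mat (char_poly_matrix A)"
  have N: "?N \<in> carrier_mat n n" "char_poly_matrix A * ?N = char_poly A \<cdot>\<^sub>m 1\<^sub>m n"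
    using adj_mat[of "char_poly_matrix A" n] A by (auto simp: char_poly_def)
  have "(z \<cdot>\<^sub>m 1\<^sub>m n - A) * ((1 / poly (char_poly A) z) \<cdot>\<^sub>m map_mat (\<lambda>q. poly q z) ?N)
      = (1 / poly (char_poly A) z) \<cdot>\<^sub>m map_mat (\<lambda>q. poly q z) (char_poly_matrix A * ?N)"
    unfolding e using A N(1) by (simp add: smult_mult_mat_dim map_mat_dim)
  also have "\<dots> = 1\<^sub>m n" using nz by (auto simp: N(2) map_mat_dim intro!: eq_matI)
  finally show "mat_inv (z \<cdot>\<^sub>m 1\<^sub>m n - A) =
       (1 / poly (char_poly A) z) \<cdot>\<^sub>m map_mat (\<lambda>q. poly q z) ?N"
    using cm N(1) by (intro mat_inv_eqI) auto
qed

text \<open>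
  All entries are brought to the characteristic polynomial as common denominator; evaluation is then
  a ring homomorphism on the numerators.
\<close>

lemma realization_mat_eval:
  assumes G: "realization p n A B C D G" and z: "\<not> eigenvalue A z"
  shows "analytic_at_pt G z" "mat_eval G z = D + C * mat_inv (z \<cdot>\<^sub>m 1\<^sub>m n - A) * B"
proof -
  have c: "A \<in> carrier_mat n n" "B \<in> carrier_mat n p" "C \<in> carrier_mat p n" "D \<in> carrier_mat p p"
    and GD: "G = const_mat D + const_mat C * resolvent n A * const_mat B"
    using G by (auto simp: realization_iff_resolvent)
  let ?q = "char_poly A" and ?N = "adj_mat (char_poly_matrix A)"
  let ?k = "map_mat (\<lambda>c. [:c:]) :: complex mat \<Rightarrow> complex poly mat"
  define M where "M = ?q \<cdot>\<^sub>m ?k D + ?k C * ?N * ?k B"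
  have N: "?N \<in> carrier_mat n n" using adj_mat(1)[of "char_poly_matrix A" n] c by auto
  have M: "M \<in> carrier_mat p p" using c N by (auto simp: M_def)
  have nz: "poly ?q z \<noteq> 0" using eigenvalue_root_char_poly[OF c(1)] z by simp
  then have q0: "?q \<noteq> 0" by auto
  have k: "const_mat X = map_mat to_fract (?k X)" for X
    by (auto intro!: eq_matI simp: rf_const_to_fract)
  have G': "G = map_mat (\<lambda>a. Fraction_Field.Fract a ?q) M"
  proof -
    interpret comm_ring_hom "to_fract :: complex poly \<Rightarrow> _" by (rule comm_ring_hom_to_fract)
    have "G = (1 / to_fract ?q) \<cdot>\<^sub>m map_mat to_fract M"
    proof -
      have "(1 / to_fract ?q) \<cdot>\<^sub>m (to_fract ?q \<cdot>\<^sub>m const_mat D) = const_mat D"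
        using q0 by (auto intro!: eq_matI)
      then show ?thesis
        using c N unfolding GD M_def resolvent_adj_mat[OF c(1)]
        by (simp add: map_mat_dim smult_mult_mat_dim smult_add_mat_dim flip: k)
    qed
    also have "\<dots> = map_mat (\<lambda>a. Fraction_Field.Fract a ?q) M"
      using q0 by (auto intro!: eq_matI simp: to_fract_def One_fract_def)
    finally show ?thesis .
  qed
  show "analytic_at_pt G z"
    unfolding analytic_at_pt_def G' using rf_eval_Fract(1)[OF nz] by (auto simp: elements_mat_def)
  note map_mat_dim = comm_ring_hom.map_mat_dim[OF comm_ring_hom_poly_eval]
  have k': "map_mat (\<lambda>q. poly q z) (?k X) = X" for X
    by (auto intro!: eq_matI)
  have "mat_eval G z = (1 / poly ?q z) \<cdot>\<^sub>m map_mat (\<lambda>q. poly q z) M"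
    unfolding mat_eval_def G' by (auto intro!: eq_matI simp: rf_eval_Fract(2)[OF nz])
  also have "\<dots> = D + C * mat_inv (z \<cdot>\<^sub>m 1\<^sub>m n - A) * B"
  proof -
    have "(1 / poly ?q z) \<cdot>\<^sub>m (poly ?q z \<cdot>\<^sub>m D) = D" using nz by (auto intro!: eq_matI)
    then show ?thesis
      using c N unfolding M_def shifted_inverse(4)[OF c(1) z]
      by (simp add: map_mat_dim smult_mult_mat_dim smult_add_mat_dim k')
  qed
  finally show "mat_eval G z = D + C * mat_inv (z \<cdot>\<^sub>m 1\<^sub>m n - A) * B" .
qed

section \<open>Stability\<close>

lemma unitary_four_block:
  assumes u: "unitary_mat (four_block_mat D C B A)"
    and D: "D \<in> carrier_mat p p" and C: "C \<in> carrier_mat p n"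
    and B: "B \<in> carrier_mat n p" and A: "A \<in> carrier_mat n n"
  shows "mat_adjoint D * D + mat_adjoint B * B = 1\<^sub>m p"
    "mat_adjoint D * C + mat_adjoint B * A = 0\<^sub>m p n"
    "mat_adjoint C * D + mat_adjoint A * B = 0\<^sub>m n p"
    "mat_adjoint C * C + mat_adjoint A * A = 1\<^sub>m n"
    "D * mat_adjoint D + C * mat_adjoint C = 1\<^sub>m p"
    "D * mat_adjoint B + C * mat_adjoint A = 0\<^sub>m p n"
    "B * mat_adjoint D + A * mat_adjoint C = 0\<^sub>m n p"
    "B * mat_adjoint B + A * mat_adjoint A = 1\<^sub>m n"
proof -
  let ?R = "four_block_mat D C B A"
  have a: "mat_adjoint ?R = four_block_mat (mat_adjoint D) (mat_adjoint B) (mat_adjoint C) (mat_adjoint A)"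
    by (rule mat_adjoint_four_block) (use assms in auto)
  have dims: "dim_row ?R = p + n" using assms by simp
  have "mat_adjoint ?R * ?R = four_block_mat (1\<^sub>m p) (0\<^sub>m p n) (0\<^sub>m n p) (1\<^sub>m n)"
    using u dims by (simp add: unitary_mat_def)
  moreover have "mat_adjoint ?R * ?R = four_block_mat
      (mat_adjoint D * D + mat_adjoint B * B) (mat_adjoint D * C + mat_adjoint B * A)
      (mat_adjoint C * D + mat_adjoint A * B) (mat_adjoint C * C + mat_adjoint A * A)"
    unfolding a by (rule mult_four_block_mat) (use assms in auto)
  ultimately have 1: "four_block_mat
      (mat_adjoint D * D + mat_adjoint B * B) (mat_adjoint D * C + mat_adjoint B * A)
      (mat_adjoint C * D + mat_adjoint A * B) (mat_adjoint C * C + mat_adjoint A * A)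
      = four_block_mat (1\<^sub>m p) (0\<^sub>m p n) (0\<^sub>m n p) (1\<^sub>m n)" by simp
  show "mat_adjoint D * D + mat_adjoint B * B = 1\<^sub>m p"
    "mat_adjoint D * C + mat_adjoint B * A = 0\<^sub>m p n"
    "mat_adjoint C * D + mat_adjoint A * B = 0\<^sub>m n p"
    "mat_adjoint C * C + mat_adjoint A * A = 1\<^sub>m n"
    by (rule four_block_mat_inject[OF 1, of p p n n]; use assms in auto)+
  have "?R * mat_adjoint ?R = four_block_mat (1\<^sub>m p) (0\<^sub>m p n) (0\<^sub>m n p) (1\<^sub>m n)"
    using u dims by (simp add: unitary_mat_def)
  moreover have "?R * mat_adjoint ?R = four_block_mat
      (D * mat_adjoint D + C * mat_adjoint C) (D * mat_adjoint B + C * mat_adjoint A)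
      (B * mat_adjoint D + A * mat_adjoint C) (B * mat_adjoint B + A * mat_adjoint A)"
    unfolding a by (rule mult_four_block_mat) (use assms in auto)
  ultimately have 2: "four_block_mat
      (D * mat_adjoint D + C * mat_adjoint C) (D * mat_adjoint B + C * mat_adjoint A)
      (B * mat_adjoint D + A * mat_adjoint C) (B * mat_adjoint B + A * mat_adjoint A)
      = four_block_mat (1\<^sub>m p) (0\<^sub>m p n) (0\<^sub>m n p) (1\<^sub>m n)" by simp
  show "D * mat_adjoint D + C * mat_adjoint C = 1\<^sub>m p"
    "D * mat_adjoint B + C * mat_adjoint A = 0\<^sub>m p n"
    "B * mat_adjoint D + A * mat_adjoint C = 0\<^sub>m n p"
    "B * mat_adjoint B + A * mat_adjoint A = 1\<^sub>m n"
    by (rule four_block_mat_inject[OF 2, of p p n n]; use assms in auto)+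
qed

text \<open>
  The energy of a state is the energy of its output plus the energy of its successor.
\<close>

lemma output_normal_norm:
  assumes C: "C \<in> carrier_mat p n" and A: "A \<in> carrier_mat n n"
    and n: "mat_adjoint C * C + mat_adjoint A * A = 1\<^sub>m n" and y: "y \<in> carrier_vec n"
  shows "Re (y \<bullet>c y) = Re ((C *\<^sub>v y) \<bullet>c (C *\<^sub>v y)) + Re ((A *\<^sub>v y) \<bullet>c (A *\<^sub>v y))"
proof -
  have "(M *\<^sub>v y) \<bullet>c (M *\<^sub>v y) = y \<bullet>c ((mat_adjoint M * M) *\<^sub>v y)"
    if "M \<in> carrier_mat k n" for M k
    using that y adjoint_mult_vec_cscalar_prod[OF that y, of "M *\<^sub>v y"]
    by (simp add: assoc_mult_mat_vec[of _ n k _ n])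
  from this[OF C] this[OF A]
  have "(C *\<^sub>v y) \<bullet>c (C *\<^sub>v y) + (A *\<^sub>v y) \<bullet>c (A *\<^sub>v y)
      = y \<bullet>c ((mat_adjoint C * C) *\<^sub>v y) + y \<bullet>c ((mat_adjoint A * A) *\<^sub>v y)" by simp
  also have "\<dots> = y \<bullet>c ((mat_adjoint C * C + mat_adjoint A * A) *\<^sub>v y)"
  proof -
    have "mat_adjoint C * C \<in> carrier_mat n n" "mat_adjoint A * A \<in> carrier_mat n n"
      using A C by auto
    then show ?thesis using y
      by (simp add: add_mult_distrib_mat_vec[of _ n n] conjugate_add_vec[of _ n]
          scalar_prod_add_distrib[of _ n])
  qed
  also have "\<dots> = y \<bullet>c y" using y by (simp add: n)
  finally show ?thesis by (metis plus_complex.sel(1))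
qed

text \<open>
  A Schur decomposition with \<open>e\<close> listed first moves an eigenvector to the first basis
  vector. If eigenvectors for \<open>e\<close> give no output, the first column of the new output
  matrix vanishes, the first state does not influence the transfer function, and deleting it gives
  a realization with one state less.
\<close>

lemma unobservable_eigenvector_not_minimal:
  assumes G: "minimal_realization p n A B C D G" and e: "eigenvalue A e"
    and C0: "\<And>v. eigenvector A v e \<Longrightarrow> C *\<^sub>v v = 0\<^sub>v p"
  shows False
proof -
  have R: "realization p n A B C D G" and least: "n = mcmillan_degree p G"
    using G by (auto simp: minimal_realization_def)
  have c: "A \<in> carrier_mat n n" "B \<in> carrier_mat n p" "C \<in> carrier_mat p n" "D \<in> carrier_mat p p"
    using R unfolding realization_def by blast+
  obtain es where es: "char_poly A = (\<Prod>a\<leftarrow>es. [:- a, 1:])" "length es = n"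
    using char_poly_factorized[OF c(1)] by auto
  have "poly (char_poly A) e = 0" using e eigenvalue_root_char_poly[OF c(1)] by simp
  then have "e \<in> set es" unfolding es(1) by (auto simp: poly_prod_list prod_list_zero_iff)
  then obtain ys zs where "es = ys @ e # zs" by (meson split_list)
  then have es':  "char_poly A = (\<Prod>a\<leftarrow>e # ys @ zs. [:- a, 1:])" and n: "n = 1 + length (ys @ zs)"
    using es by (simp_all add: mult.left_commute del: mult_pCons_left mult_pCons_right)
  define m where "m = length (ys @ zs)"
  obtain T P Q where "schur_decomposition A (e # ys @ zs) = (T, P, Q)"
    by (metis prod_cases3)
  from schur_decomposition[OF c(1) es' this]
  have sim: "similar_mat_wit A T P Q" and ut: "upper_triangular T" and diag: "diag_mat T = e # ys @ zs"
    by auto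
  note s = similar_mat_witD2[OF c(1) sim]
  have n1: "n = 1 + m" using n by (simp add: m_def)
  have T00: "T $$ (0, 0) = e"
  proof -
    have "diag_mat T ! 0 = e" by (simp add: diag)
    then show ?thesis using s(5) n1 by (simp add: diag_mat_def del: upt_Suc)
  qed
  let ?u = "unit_vec n 0 :: complex vec"
  have Tu: "T *\<^sub>v ?u = e \<cdot>\<^sub>v ?u"
  proof (rule eq_vecI)
    fix i assume "i < dim_vec (e \<cdot>\<^sub>v ?u)"
    then show "(T *\<^sub>v ?u) $ i = (e \<cdot>\<^sub>v ?u) $ i"
      using s(5) n1 T00 upper_triangularD[OF ut, of 0 i] by (cases "i = 0") auto
  qed (use s(5) in auto)
  have "eigenvector A (P *\<^sub>v ?u) e"
    unfolding eigenvector_def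
  proof (intro conjI)
    show "P *\<^sub>v ?u \<in> carrier_vec (dim_row A)" using s by auto
    have "Q *\<^sub>v (P *\<^sub>v ?u) = ?u"
      using s by (simp flip: assoc_mult_mat_vec[of Q n n P n])
    moreover have "Q *\<^sub>v 0\<^sub>v n = 0\<^sub>v n" using s by auto
    moreover have "?u \<noteq> 0\<^sub>v n"
    proof
      assume "?u = 0\<^sub>v n"
      then have "?u $ 0 = 0\<^sub>v n $ 0" by (rule arg_cong)
      then show False using n1 by (simp del: vec_of_dim_0)
    qed
    ultimately show "P *\<^sub>v ?u \<noteq> 0\<^sub>v (dim_row A)"
      using c(1) by (metis carrier_matD(1))
    have "A *\<^sub>v (P *\<^sub>v ?u) = (A * P) *\<^sub>v ?u"
      by (rule assoc_mult_mat_vec[OF s(4,6) unit_vec_carrier, symmetric])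
    also have "A * P = P * T"
      using s(1,2,5-7) unfolding s(3) by (simp add: mat_ring_simps)
    also have "(P * T) *\<^sub>v ?u = P *\<^sub>v (T *\<^sub>v ?u)"
      by (rule assoc_mult_mat_vec[OF s(6,5) unit_vec_carrier])
    also have "\<dots> = e \<cdot>\<^sub>v (P *\<^sub>v ?u)"
      unfolding Tu by (rule mult_mat_vec[OF s(6) unit_vec_carrier])
    finally show "A *\<^sub>v (P *\<^sub>v ?u) = e \<cdot>\<^sub>v (P *\<^sub>v ?u)" .
  qed
  then have "C *\<^sub>v (P *\<^sub>v ?u) = 0\<^sub>v p" by (rule C0)
  then have CP0: "(C * P) *\<^sub>v ?u = 0\<^sub>v p"
    using s c by (simp add: assoc_mult_mat_vec[of C p n P n])
  obtain W N Z A' where T: "W \<in> carrier_mat 1 1" "N \<in> carrier_mat 1 m" "Z \<in> carrier_mat m 1"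
    "A' \<in> carrier_mat m m" "T = four_block_mat W N Z A'"
    using s(5) four_block_mat_exhaust[of T 1 m 1 m] n1 by metis
  have Z: "Z = 0\<^sub>m m 1"
  proof (rule eq_matI)
    fix i j assume ij: "i < dim_row (0\<^sub>m m 1 :: complex mat)" "j < dim_col (0\<^sub>m m 1 :: complex mat)"
    then have "T $$ (Suc i, 0) = 0" using upper_triangularD[OF ut, of 0 "Suc i"] s(5) n1 by auto
    then show "Z $$ (i, j) = 0\<^sub>m m 1 $$ (i, j)" using T(1-4) ij unfolding T(5) by auto
  qed (use T in auto)
  \<comment> \<open>In the new basis, the first state contributes the row \<open>b\<close> to the input matrix and a
    zero column to the output matrix.\<close>
  define b where "b = mat 1 p (\<lambda>(i, j). (Q * B) $$ (i, j))"
  define B' where "B' = mat m p (\<lambda>(i, j). (Q * B) $$ (Suc i, j))"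
  define C' where "C' = mat p m (\<lambda>(i, j). (C * P) $$ (i, Suc j))"
  have QB: "Q * B = b @\<^sub>r B'"
    using s c n1 by (auto intro!: eq_matI simp: b_def B'_def append_rows_def)
  have CP: "C * P = append_cols (0\<^sub>m p 1) C'"
  proof (rule eq_matI)
    fix i j assume "i < dim_row (append_cols (0\<^sub>m p 1) C')" "j < dim_col (append_cols (0\<^sub>m p 1) C')"
    then have ij: "i < p" "j < n" using n1 by (auto simp: append_cols_def C'_def)
    have "(C * P) $$ (i, 0) = 0"
      using arg_cong[OF CP0, of "\<lambda>v. v $ i"] ij c s n1 by simp
    then show "(C * P) $$ (i, j) = append_cols (0\<^sub>m p 1) C' $$ (i, j)"
      using ij c s n1 by (cases j) (auto simp: append_cols_def C'_def)
  qed (use c s n1 in \<open>auto simp: append_cols_def C'_def\<close>)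
  have c': "b \<in> carrier_mat 1 p" "B' \<in> carrier_mat m p" "C' \<in> carrier_mat p m"
    by (auto simp: b_def B'_def C'_def)
  have "realization p (1 + m) (four_block_mat W N (0\<^sub>m m 1) A') (b @\<^sub>r B') (append_cols (0\<^sub>m p 1) C') D G"
    using realization_similar[OF R sim] unfolding T(5) Z QB CP n1 .
  from realization_triangular[OF this T(1,2,4) c'(1,2) _ c'(3)]
  have "G = const_mat D + const_mat C' * resolvent m A' * const_mat B'"
    using T c' c resolvent(1)[OF T(1)] resolvent(1)[OF T(4)]
    by (simp add: const_mat_simps mat_ring_simps)
  then have "realization p m A' B' C' D G"
    using T c c' by (simp add: realization_iff_resolvent)
  then have "mcmillan_degree p G \<le> m"
    unfolding mcmillan_degree_def by (intro Least_le) auto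
  then show False using least n1 by simp
qed

text \<open>
  By the energy balance an eigenvalue satisfies \<open>\<bar>e\<bar> \<le> 1\<close>, with
  equality only for eigenvectors that give no output; minimality excludes these.
\<close>

lemma balanced_realization_stable:
  assumes b: "balanced_realization p n A B C D G"
  shows "stable_mat A"
  unfolding stable_mat_def
proof (intro allI impI, rule ccontr)
  fix e assume e: "eigenvalue A e" and "\<not> cmod e < 1"
  then have e1: "1 \<le> cmod e" by simp
  have G: "minimal_realization p n A B C D G" and u: "unitary_mat (four_block_mat D C B A)"
    using b by (auto simp: balanced_realization_def)
  have c: "A \<in> carrier_mat n n" "B \<in> carrier_mat n p" "C \<in> carrier_mat p n" "D \<in> carrier_mat p p"
    using G unfolding minimal_realization_def realization_def by blast+
  show False
  proof (rule unobservable_eigenvector_not_minimal[OF G e])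
    fix v assume "eigenvector A v e"
    then have v: "v \<in> carrier_vec n" "A *\<^sub>v v = e \<cdot>\<^sub>v v"
      using c by (auto simp: eigenvector_def)
    have "Re ((e \<cdot>\<^sub>v v) \<bullet>c (e \<cdot>\<^sub>v v)) = Re ((e * cnj e) * (v \<bullet>c v))"
      using v by (simp add: conjugate_smult_vec ac_simps)
    also have "\<dots> = (cmod e)\<^sup>2 * Re (v \<bullet>c v)"
      by (simp add: complex_mult_cnj cmod_power2)
    finally have "Re (v \<bullet>c v) = Re ((C *\<^sub>v v) \<bullet>c (C *\<^sub>v v)) + (cmod e)\<^sup>2 * Re (v \<bullet>c v)"
      using output_normal_norm[OF c(3,1) unitary_four_block(4)[OF u c(4,3,2,1)] v(1)] v(2) by simp
    moreover have "Re (v \<bullet>c v) \<le> (cmod e)\<^sup>2 * Re (v \<bullet>c v)"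
      using e1 cscalar_prod_self_nonneg[of v] by (simp add: mult_le_cancel_right1)
    ultimately have "\<not> 0 < Re ((C *\<^sub>v v) \<bullet>c (C *\<^sub>v v))" by linarith
    then show "C *\<^sub>v v = 0\<^sub>v p"
      using cscalar_prod_self_pos[of "C *\<^sub>v v" p] c v by auto
  qed
qed

lemma smult_pow_mat:
  assumes "A \<in> carrier_mat n n"
  shows "(c \<cdot>\<^sub>m A) ^\<^sub>m k = c ^ k \<cdot>\<^sub>m (A ^\<^sub>m k :: complex mat)"
proof (induction k)
  case (Suc k)
  have "A ^\<^sub>m k \<in> carrier_mat n n" using assms by simp
  then show ?case using assms Suc
    by (auto simp: smult_mult_mat_dim ac_simps intro!: eq_matI)
qed (use assms in \<open>auto intro!: eq_matI\<close>)

text \<open>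
  Dividing \<open>W\<close> by a number \<open>r\<close> strictly between its spectral radius and
  1 leaves a matrix with bounded powers, so the powers of \<open>W\<close> decay like
  \<open>r\<^sup>k\<close>.
\<close>

lemma stable_pow_tendsto_zero:
  assumes W: "W \<in> carrier_mat n n" and st: "stable_mat W" and ij: "i < n" "j < n"
  shows "(\<lambda>k. (W ^\<^sub>m k) $$ (i, j)) \<longlonglongrightarrow> 0"
proof -
  have n: "n > 0" using ij by simp
  note max = spectral_radius_mem_max[OF _ n]
  have \<rho>: "0 \<le> spectral_radius W" "spectral_radius W < 1"
    using max(1)[OF W] st by (auto simp: stable_mat_def spectrum_def)
  obtain r where r: "spectral_radius W < r" "r < 1" using dense[OF \<rho>(2)] by auto
  with \<rho> have r0: "r > 0" by simp
  define M where "M = complex_of_real (1 / r) \<cdot>\<^sub>m W"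
  have M: "M \<in> carrier_mat n n" using W by (simp add: M_def)
  have WM: "W = complex_of_real r \<cdot>\<^sub>m M" using r0 by (auto intro!: eq_matI simp: M_def)
  have "spectral_radius M < 1"
  proof -
    obtain e where e: "eigenvalue M e" "spectral_radius M = cmod e"
      using max(1)[OF M] by (auto simp: spectrum_def)
    then obtain v where v: "v \<in> carrier_vec n" "v \<noteq> 0\<^sub>v n" "M *\<^sub>v v = e \<cdot>\<^sub>v v"
      using M by (auto simp: eigenvalue_def eigenvector_def)
    have Mv: "dim_col M = dim_vec v" using M v(1) by simp
    have "W *\<^sub>v v = (r * e) \<cdot>\<^sub>v v"
      unfolding WM smult_mult_mat_vec_dim[OF Mv] using v by (simp add: smult_smult_assoc)
    then have "eigenvalue W (r * e)" using v W by (auto simp: eigenvalue_def eigenvector_def)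
    then have "cmod (r * e) \<le> spectral_radius W"
      by (intro max(2)[OF W]) (auto simp: spectrum_def)
    then have "r * cmod e \<le> spectral_radius W" using r0 by (simp add: norm_mult)
    then have "r * cmod e < r * 1" using r by linarith
    then show ?thesis using e r0 by (simp only: mult_less_cancel_left_pos)
  qed
  then obtain b where b: "\<And>k. norm_bound (M ^\<^sub>m k) b"
    using spectral_radius_jnf_norm_bound_less_1_upper_triangular[OF M] by auto
  have bound: "cmod ((W ^\<^sub>m k) $$ (i, j)) \<le> r ^ k * b" for k
  proof -
    have Mk: "M ^\<^sub>m k \<in> carrier_mat n n" using M by simp
    then have "cmod ((M ^\<^sub>m k) $$ (i, j)) \<le> b" using b[of k] ij unfolding norm_bound_def carrier_matD[OF Mk] by simp
    moreover have "(W ^\<^sub>m k) $$ (i, j) = complex_of_real r ^ k * (M ^\<^sub>m k) $$ (i, j)"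
      unfolding WM smult_pow_mat[OF M] using M ij by simp
    ultimately show ?thesis using r0 by (simp add: norm_mult norm_power mult_left_mono)
  qed
  have "(\<lambda>k. r ^ k * b) \<longlonglongrightarrow> 0 * b"
    using r r0 by (intro tendsto_mult LIMSEQ_power_zero tendsto_const) auto
  then have "(\<lambda>k. r ^ k * b) \<longlonglongrightarrow> 0" by simp
  then show ?thesis
  proof (rule tendsto_0_le[of _ _ _ 1])
    show "\<forall>\<^sub>F k in sequentially. norm ((W ^\<^sub>m k) $$ (i, j)) \<le> norm (r ^ k * b) * 1"
      using order_trans[OF bound abs_ge_self] by (simp only: real_norm_def mult_1_right eventually_True)
  qed
qed

text \<open>
  Iterating the equation gives \<open>D = (W\<^sup>k)\<^sup>* D W\<^sup>k\<close>, and the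
  right-hand side tends to 0.
\<close>

lemma stein_unique:
  assumes W: "W \<in> carrier_mat n n" and st: "stable_mat W" and D: "D \<in> carrier_mat n n"
    and eq: "mat_adjoint W * D * W = D"
  shows "D = 0\<^sub>m n n"
proof (rule eq_matI)
  have it: "D = mat_adjoint (W ^\<^sub>m k) * D * W ^\<^sub>m k" for k
  proof (induction k)
    case 0
    show ?case using W D by (simp add: mat_adjoint_simps)
  next
    case (Suc k)
    have "mat_adjoint (W ^\<^sub>m Suc k) * D * W ^\<^sub>m Suc k
        = mat_adjoint W * (mat_adjoint (W ^\<^sub>m k) * D * W ^\<^sub>m k) * W"
      using W D by (simp add: mat_adjoint_simps mat_ring_simps)
    then show ?case using eq by (simp flip: Suc)
  qed
  fix i j assume "i < dim_row (0\<^sub>m n n :: complex mat)" "j < dim_col (0\<^sub>m n n :: complex mat)"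
  then have ij: "i < n" "j < n" by auto
  have "(mat_adjoint (W ^\<^sub>m k) * D * W ^\<^sub>m k) $$ (i, j)
      = (\<Sum>b<n. (\<Sum>a<n. cnj ((W ^\<^sub>m k) $$ (a, i)) * D $$ (a, b)) * (W ^\<^sub>m k) $$ (b, j))" for k
    using W D ij by (simp add: scalar_prod_def lessThan_atLeast0)
  then have "D $$ (i, j) = (\<Sum>b<n. (\<Sum>a<n. cnj ((W ^\<^sub>m k) $$ (a, i)) * D $$ (a, b)) * (W ^\<^sub>m k) $$ (b, j))" for k
    by (rule trans[OF arg_cong[OF it, of "\<lambda>M. M $$ (i, j)"]])
  moreover have "(\<lambda>k. \<Sum>b<n. (\<Sum>a<n. cnj ((W ^\<^sub>m k) $$ (a, i)) * D $$ (a, b)) * (W ^\<^sub>m k) $$ (b, j))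
      \<longlonglongrightarrow> (\<Sum>b<n. (\<Sum>a<n. cnj 0 * D $$ (a, b)) * 0)"
    using ij by (intro tendsto_sum tendsto_mult tendsto_cnj tendsto_const stable_pow_tendsto_zero[OF W st]) auto
  ultimately have "(\<lambda>k::nat. D $$ (i, j)) \<longlonglongrightarrow> 0" by simp
  then show "D $$ (i, j) = 0\<^sub>m n n $$ (i, j)" using ij by (simp add: LIMSEQ_const_iff)
qed (use D in auto)

text \<open>
  A state that never produces an output keeps its energy along its trajectory, while the
  trajectory of a stable system tends to 0.
\<close>

lemma output_normal_observable:
  assumes W: "W \<in> carrier_mat n n" and st: "stable_mat W" and U: "U \<in> carrier_mat p n"
    and nrm: "mat_adjoint U * U + mat_adjoint W * W = 1\<^sub>m n"
  shows "observable U W"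
  unfolding observable_def
proof (intro ballI impI)
  fix x assume "x \<in> carrier_vec (dim_row W)" and "\<forall>k. (U * W ^\<^sub>m k) *\<^sub>v x = 0\<^sub>v (dim_row U)"
  then have x: "x \<in> carrier_vec n" and Ux: "\<And>k. (U * W ^\<^sub>m k) *\<^sub>v x = 0\<^sub>v p"
    using W U by auto
  have Wk: "W ^\<^sub>m k \<in> carrier_mat n n" for k using W by simp
  have step: "W ^\<^sub>m Suc k *\<^sub>v x = W *\<^sub>v (W ^\<^sub>m k *\<^sub>v x)" for k
  proof -
    have "W ^\<^sub>m Suc k = W * W ^\<^sub>m k"
    proof (induction k)
      case 0 then show ?case using W by simp
    next
      case (Suc k) then show ?case using W by (simp add: assoc_mult_mat_dim)
    qed
    then show ?thesis using W Wk x by (simp add: assoc_mult_mat_vec[of W n n _ n])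
  qed
  have const: "Re ((W ^\<^sub>m k *\<^sub>v x) \<bullet>c (W ^\<^sub>m k *\<^sub>v x)) = Re (x \<bullet>c x)" for k
  proof (induction k)
    case 0 then show ?case using W x by simp
  next
    case (Suc k)
    have y: "W ^\<^sub>m k *\<^sub>v x \<in> carrier_vec n" using Wk[of k] x by auto
    have "U *\<^sub>v (W ^\<^sub>m k *\<^sub>v x) = 0\<^sub>v p"
      using Ux[of k] U Wk[of k] x by (simp add: assoc_mult_mat_vec[of U p n _ n])
    then show ?case using output_normal_norm[OF U W nrm y] Suc step[of k] by simp
  qed
  have "(\<lambda>k. (W ^\<^sub>m k *\<^sub>v x) $ i) \<longlonglongrightarrow> 0" if i: "i < n" for i
  proof -
    have "(W ^\<^sub>m k *\<^sub>v x) $ i = (\<Sum>j<n. (W ^\<^sub>m k) $$ (i, j) * x $ j)" for k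
      using W Wk[of k] x i by (simp add: scalar_prod_def lessThan_atLeast0)
    moreover have "(\<lambda>k. \<Sum>j<n. (W ^\<^sub>m k) $$ (i, j) * x $ j) \<longlonglongrightarrow> (\<Sum>j<n. 0 * x $ j)"
      using i by (intro tendsto_sum tendsto_mult tendsto_const stable_pow_tendsto_zero[OF W st]) auto
    ultimately show ?thesis by simp
  qed
  then have "(\<lambda>k. \<Sum>i<n. (W ^\<^sub>m k *\<^sub>v x) $ i * cnj ((W ^\<^sub>m k *\<^sub>v x) $ i)) \<longlonglongrightarrow> (\<Sum>i<n. 0 * cnj 0)"
    by (intro tendsto_sum tendsto_mult tendsto_cnj) auto
  moreover have "(W ^\<^sub>m k *\<^sub>v x) \<bullet>c (W ^\<^sub>m k *\<^sub>v x)
      = (\<Sum>i<n. (W ^\<^sub>m k *\<^sub>v x) $ i * cnj ((W ^\<^sub>m k *\<^sub>v x) $ i))" for k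
    using W Wk[of k] by (simp add: scalar_prod_def lessThan_atLeast0)
  ultimately have "(\<lambda>k. (W ^\<^sub>m k *\<^sub>v x) \<bullet>c (W ^\<^sub>m k *\<^sub>v x)) \<longlonglongrightarrow> 0" by simp
  then have "(\<lambda>k. Re ((W ^\<^sub>m k *\<^sub>v x) \<bullet>c (W ^\<^sub>m k *\<^sub>v x))) \<longlonglongrightarrow> Re 0"
    by (rule tendsto_Re)
  then have "(\<lambda>k::nat. Re (x \<bullet>c x)) \<longlonglongrightarrow> Re 0" unfolding const .
  then have "\<not> 0 < Re (x \<bullet>c x)" by (simp add: LIMSEQ_const_iff)
  then show "x = 0\<^sub>v (dim_row W)" using cscalar_prod_self_pos[OF x] W by auto
qed

section \<open>Lossless functions from unitary realizations\<close>

text \<open>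
  The state space form of contractivity. Since the rows of the realization matrix are orthonormal,
  all products involving \<open>D\<close> or \<open>B\<close> with an adjoint can be expressed by
  \<open>C\<close> and \<open>A\<close>; the resolvent identity \<open>F A = z F - I\<close> then
  removes \<open>A\<close>.
\<close>

lemma realization_defect:
  assumes c: "A \<in> carrier_mat n n" "B \<in> carrier_mat n p" "C \<in> carrier_mat p n" "D \<in> carrier_mat p p"
    and DD: "D * mat_adjoint D + C * mat_adjoint C = 1\<^sub>m p"
    and DB: "D * mat_adjoint B + C * mat_adjoint A = 0\<^sub>m p n"
    and BD: "B * mat_adjoint D + A * mat_adjoint C = 0\<^sub>m n p"
    and BB: "B * mat_adjoint B + A * mat_adjoint A = 1\<^sub>m n"
    and F: "F \<in> carrier_mat n n" and FE: "F * (z \<cdot>\<^sub>m 1\<^sub>m n - A) = 1\<^sub>m n"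
  shows "1\<^sub>m p - (D + C * F * B) * mat_adjoint (D + C * F * B)
    = complex_of_real ((cmod z)\<^sup>2 - 1) \<cdot>\<^sub>m ((C * F) * mat_adjoint (C * F))"
proof -
  have DD': "D * mat_adjoint D = 1\<^sub>m p + - (C * mat_adjoint C)"
    using mat_add_move[OF DD] c by (simp add: cancel_mat_dim)
  have DB': "D * mat_adjoint B = - (C * mat_adjoint A)"
    using mat_add_move[OF DB] c by (simp add: cancel_mat_dim)
  have BD': "B * mat_adjoint D = - (A * mat_adjoint C)"
    using mat_add_move[OF BD] c by (simp add: cancel_mat_dim)
  have BB': "B * mat_adjoint B = 1\<^sub>m n + - (A * mat_adjoint A)"
    using mat_add_move[OF BB] c by (simp add: cancel_mat_dim)
  have "z \<cdot>\<^sub>m F + - (F * A) = 1\<^sub>m n"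
    using FE c F by (simp add: mult_add_mat_dim diff_mat_dim smult_mult_mat_dim unit_mat_dim mult_uminus_mat_dim)
  then have FA: "F * A = z \<cdot>\<^sub>m F + - 1\<^sub>m n"
    using mat_diff_eq_move[of "z \<cdot>\<^sub>m F" "F * A" "1\<^sub>m n"] c F by simp
  have AF: "mat_adjoint A * mat_adjoint F = cnj z \<cdot>\<^sub>m mat_adjoint F + - 1\<^sub>m n"
    using arg_cong[OF FA, of mat_adjoint] c F by (simp add: mat_adjoint_simps)
  note dist = assoc_mult_mat_dim mult_add_mat_dim add_mult_mat_dim diff_mat_dim mult_uminus_mat_dim
    uminus_mult_mat_dim uminus_add_mat_dim unit_mat_dim add_assoc_mat_dim mat_adjoint_simps
    smult_mult_mat_dim smult_add_mat_dim smult_uminus_mat smult_smult_mat cancel_mat_dim(7)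
  note rel = DD' DB' BD' BB' FA AF
  note rel_cong = mult_mat_cong_left[OF DD'] mult_mat_cong_left[OF DB'] mult_mat_cong_left[OF BD']
    mult_mat_cong_left[OF BB'] mult_mat_cong_left[OF FA] mult_mat_cong_left[OF AF]
  have zz: "z * cnj z = (complex_of_real (cmod z))\<^sup>2"
    using complex_norm_square[of z] by simp
  \<comment> \<open>After expansion both sides are scalar combinations of the same few products, compared entrywise.\<close>
  show ?thesis
    using c F
    by (simp add: dist rel rel_cong,
        intro eq_matI; simp del: index_mult_mat(1) add: algebra_simps zz)
qed

lemma unitary_realization_lossless:
  assumes G: "realization p n A B C D G" and st: "stable_mat A"
    and u: "D * mat_adjoint D + C * mat_adjoint C = 1\<^sub>m p"
      "D * mat_adjoint B + C * mat_adjoint A = 0\<^sub>m p n"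
      "B * mat_adjoint D + A * mat_adjoint C = 0\<^sub>m n p"
      "B * mat_adjoint B + A * mat_adjoint A = 1\<^sub>m n"
  shows "lossless p G"
proof -
  have c: "A \<in> carrier_mat n n" "B \<in> carrier_mat n p" "C \<in> carrier_mat p n" "D \<in> carrier_mat p p"
    and Gc: "G \<in> carrier_mat p p"
    using G resolvent(1)[of A n] by (auto simp: realization_iff_resolvent)
  have main: "analytic_at_pt G z \<and> (\<exists>M \<in> carrier_mat p n. 1\<^sub>m p - mat_eval G z * mat_adjoint (mat_eval G z)
      = complex_of_real ((cmod z)\<^sup>2 - 1) \<cdot>\<^sub>m (M * mat_adjoint M))" if "1 \<le> cmod z" for z
  proof -
    have z: "\<not> eigenvalue A z" using st that by (force simp: stable_mat_def)
    let ?F = "mat_inv (z \<cdot>\<^sub>m 1\<^sub>m n - A)"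
    note F = shifted_inverse[OF c(1) z]
    have "1\<^sub>m p - mat_eval G z * mat_adjoint (mat_eval G z)
      = complex_of_real ((cmod z)\<^sup>2 - 1) \<cdot>\<^sub>m ((C * ?F) * mat_adjoint (C * ?F))"
      unfolding realization_mat_eval(2)[OF G z]
      by (rule realization_defect[OF c u F(1,3)])
    moreover have "C * ?F \<in> carrier_mat p n" using c F(1) by auto
    ultimately show ?thesis using realization_mat_eval(1)[OF G z] by blast
  qed
  show ?thesis
    unfolding lossless_def
  proof (intro conjI allI impI)
    show "G \<in> carrier_mat p p" by (rule Gc)
    fix z :: complex
    {
      assume z: "1 < cmod z"
      then show "analytic_at_pt G z" using main[of z] by simp
      obtain M where M: "M \<in> carrier_mat p n" "1\<^sub>m p - mat_eval G z * mat_adjoint (mat_eval G z)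
          = complex_of_real ((cmod z)\<^sup>2 - 1) \<cdot>\<^sub>m (M * mat_adjoint M)" using main[of z] z by auto
      have "0 \<le> (cmod z)\<^sup>2 - 1" using z by (simp add: one_le_power)
      then show "pos_semidef p (1\<^sub>m p - mat_eval G z * mat_adjoint (mat_eval G z))"
        unfolding M(2) by (rule pos_semidef_mult_adjoint[OF M(1)])
    next
      assume z: "cmod z = 1"
      then show "analytic_at_pt G z" using main[of z] by simp
      let ?H = "mat_eval G z * mat_adjoint (mat_eval G z)"
      have H: "?H \<in> carrier_mat p p" using Gc by (auto simp: mat_eval_def)
      obtain M where M: "M \<in> carrier_mat p n" "1\<^sub>m p - ?H = 0 \<cdot>\<^sub>m (M * mat_adjoint M)"
        using main[of z] z by auto
      moreover have "0 \<cdot>\<^sub>m (M * mat_adjoint M) = 0\<^sub>m p p" using M(1) by (auto intro!: eq_matI)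
      moreover have "1\<^sub>m p - ?H = 1\<^sub>m p + - ?H" using H by (intro diff_mat_dim) auto
      ultimately have "1\<^sub>m p + - ?H = 0\<^sub>m p p" by simp
      from mat_diff_eq_move[OF this] show "?H = 1\<^sub>m p" using H by (auto simp: cancel_mat_dim)
    }
  qed
qed

section \<open>Interpolation data with \<open>V = 0\<close>\<close>

text \<open>
  The normalization \<open>U\<^sup>* U + W\<^sup>* W = I\<close> says that the identity solves the
  Stein equation with \<open>V = 0\<close>.
\<close>

lemma stein_solution_normalized:
  assumes W: "W \<in> carrier_mat d d" and U: "U \<in> carrier_mat p d" and st: "stable_mat W"
    and nrm: "mat_adjoint U * U + mat_adjoint W * W = 1\<^sub>m d"
  shows "stein_solution W U (0\<^sub>m p d) = 1\<^sub>m d"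
  unfolding stein_solution_def
proof (rule the_equality)
  have UU: "mat_adjoint U * U = 1\<^sub>m d + - (mat_adjoint W * W)"
    using mat_add_move[OF nrm] W U by simp
  have z: "mat_adjoint (0\<^sub>m p d) * 0\<^sub>m p d = (0\<^sub>m d d :: complex mat)"
    by (simp add: mat_adjoint_simps)
  show "1\<^sub>m d \<in> carrier_mat (dim_row W) (dim_row W) \<and>
    1\<^sub>m d - mat_adjoint W * 1\<^sub>m d * W = mat_adjoint U * U - mat_adjoint (0\<^sub>m p d) * 0\<^sub>m p d"
    using W U unfolding UU z by (simp add: mat_ring_simps)
  fix P assume P: "P \<in> carrier_mat (dim_row W) (dim_row W) \<and>
    P - mat_adjoint W * P * W = mat_adjoint U * U - mat_adjoint (0\<^sub>m p d) * 0\<^sub>m p d"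
  then have Pc: "P \<in> carrier_mat d d" and eq: "P + - (mat_adjoint W * (P * W)) = 1\<^sub>m d + - (mat_adjoint W * W)"
    using W U unfolding UU z by (auto simp: mat_ring_simps)
  have PW: "mat_adjoint W * (P * W) = P + - (1\<^sub>m d + - (mat_adjoint W * W))"
    using mat_diff_eq_move[OF eq] W Pc by simp
  have "P - 1\<^sub>m d = 0\<^sub>m d d"
  proof (rule stein_unique[OF W st])
    show "mat_adjoint W * (P - 1\<^sub>m d) * W = P - 1\<^sub>m d"
      using W Pc by (simp add: mat_ring_simps PW)
  qed (use Pc in auto)
  then have "P + - 1\<^sub>m d = 0\<^sub>m d d" using Pc by (simp add: diff_mat_dim)
  from mat_diff_eq_move[OF this] show "P = 1\<^sub>m d" using Pc by (simp add: cancel_mat_dim)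
qed

text \<open>
  The interpolation data \<open>(W, U, 0)\<close>. Below, \<open>X\<close> and \<open>Y\<close>
  are the blocks that complete the orthonormal columns \<open>U\<close>, \<open>W\<close> to a
  unitary matrix, and \<open>R\<close> and \<open>S\<close> are the two adjoint resolvent values
  at the point 1, at which the elementary factor is normalized to the identity.
\<close>

locale interpolation_data =
  fixes p d :: nat and W U :: "complex mat"
  assumes W [simp]: "W \<in> carrier_mat d d" and U [simp]: "U \<in> carrier_mat p d"
    and stable: "stable_mat W"
    and normalized: "mat_adjoint U * U + mat_adjoint W * W = 1\<^sub>m d"
begin

definition R :: "complex mat" where "R = mat_inv (1\<^sub>m d - mat_adjoint W)"
definition S :: "complex mat" where "S = mat_inv (1\<^sub>m d - W)"
definition X :: "complex mat" where "X = 1\<^sub>m p - U * R * mat_adjoint U"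
definition Y :: "complex mat" where "Y = (1\<^sub>m d - W) * R * mat_adjoint U"

lemma data_dims [simp]: "dim_row W = d" "dim_col W = d" "dim_row U = p" "dim_col U = d"
  using carrier_matD[OF W] carrier_matD[OF U] by auto

lemma S: "S \<in> carrier_mat d d" "(1\<^sub>m d - W) * S = 1\<^sub>m d" "S * (1\<^sub>m d - W) = 1\<^sub>m d"
proof -
  have "\<not> eigenvalue W 1" using stable by (auto simp: stable_mat_def)
  moreover have "1 \<cdot>\<^sub>m 1\<^sub>m d - W = 1\<^sub>m d - W" by (auto intro!: eq_matI)
  ultimately
  show "S \<in> carrier_mat d d" "(1\<^sub>m d - W) * S = 1\<^sub>m d" "S * (1\<^sub>m d - W) = 1\<^sub>m d"
    using shifted_inverse(1-3)[OF W, of 1] by (auto simp: S_def)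
qed

lemma R_adjoint: "R = mat_adjoint S"
  unfolding R_def
proof (rule mat_inv_eqI[of _ d])
  show "(1\<^sub>m d - mat_adjoint W) * mat_adjoint S = 1\<^sub>m d"
    using arg_cong[OF S(3), of mat_adjoint] S(1) W by (simp add: mat_adjoint_simps)
qed (use S W in auto)

lemma adjoint_R: "mat_adjoint R = S" "mat_adjoint S = R"
  by (simp_all add: R_adjoint mat_adjoint_simps)

lemma R: "R \<in> carrier_mat d d" "(1\<^sub>m d - mat_adjoint W) * R = 1\<^sub>m d" "R * (1\<^sub>m d - mat_adjoint W) = 1\<^sub>m d"
  using S(1) arg_cong[OF S(2), of mat_adjoint] arg_cong[OF S(3), of mat_adjoint] W
  by (auto simp: mat_adjoint_simps R_adjoint)

lemma X_carrier [simp]: "X \<in> carrier_mat p p" and Y_carrier [simp]: "Y \<in> carrier_mat d p"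
  using R(1) W U by (auto simp: X_def Y_def)

lemma dims [simp]:
  "dim_row R = d" "dim_col R = d" "dim_row S = d" "dim_col S = d"
  "dim_row X = p" "dim_col X = p" "dim_row Y = d" "dim_col Y = p"
  using R(1) S(1) carrier_matD[OF X_carrier] carrier_matD[OF Y_carrier] by auto

text \<open>
  With these relations, oriented from left to right, every word in \<open>U\<close>,
  \<open>W\<close>, \<open>R\<close>, \<open>S\<close> and their adjoints that occurs below is
  rewritten to a normal form, so that the remaining identities follow by computation.
\<close>

lemma shift_rules:
  "R * mat_adjoint W = R + - 1\<^sub>m d" "mat_adjoint W * R = R + - 1\<^sub>m d"
  "S * W = S + - 1\<^sub>m d" "W * S = S + - 1\<^sub>m d"
  "mat_adjoint U * U = 1\<^sub>m d + - (mat_adjoint W * W)"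
proof -
  show "R * mat_adjoint W = R + - 1\<^sub>m d" "mat_adjoint W * R = R + - 1\<^sub>m d"
    "S * W = S + - 1\<^sub>m d" "W * S = S + - 1\<^sub>m d"
    using R S by (intro mat_diff_eq_move; simp add: mult_add_mat_dim add_mult_mat_dim diff_mat_dim
        mult_uminus_mat_dim uminus_mult_mat_dim unit_mat_dim)+
  show "mat_adjoint U * U = 1\<^sub>m d + - (mat_adjoint W * W)"
    using mat_add_move[OF normalized] by simp
qed

lemmas shift_simps = shift_rules shift_rules[THEN mult_mat_cong_left] adjoint_R

text \<open>
  These are the statements \<open>Z = I\<close>, \<open>L = 0\<close> and the adjoint of the
  latter for the auxiliary matrices in the definition of the unitary pair. Together with the
  normalization they say that the matrix with blocks \<open>X\<close>, \<open>U\<close>,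
  \<open>Y\<close>, \<open>W\<close> is unitary.
\<close>

lemma column_relations:
  "mat_adjoint X * X + mat_adjoint Y * Y = 1\<^sub>m p"
  "mat_adjoint U * X + mat_adjoint W * Y = 0\<^sub>m d p"
  "mat_adjoint X * U + mat_adjoint Y * W = 0\<^sub>m p d"
proof -
  show "mat_adjoint X * X + mat_adjoint Y * Y = 1\<^sub>m p"
    unfolding X_def Y_def by (simp add: mat_ring_simps mat_adjoint_simps shift_simps)
  show 1: "mat_adjoint U * X + mat_adjoint W * Y = 0\<^sub>m d p"
    unfolding X_def Y_def by (simp add: mat_ring_simps mat_adjoint_simps shift_simps)
  show "mat_adjoint X * U + mat_adjoint Y * W = 0\<^sub>m p d"
    using arg_cong[OF 1, of mat_adjoint] by (simp add: mat_adjoint_simps)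
qed

text \<open>
  The columns of \<open>(X, Y)\<close> form an orthonormal basis of the orthogonal complement of
  the columns of \<open>(U, W)\<close>. Hence a column \<open>(M, N)\<close> orthogonal to
  \<open>(U, W)\<close> has unique coordinates \<open>D\<close> in this basis, and the explicit
  form of \<open>X\<close> and \<open>Y\<close> yields the formula.
\<close>

lemma XY_complete:
  assumes M: "M \<in> carrier_mat p k" and N: "N \<in> carrier_mat d k"
    and orth: "mat_adjoint U * M + mat_adjoint W * N = 0\<^sub>m d k" and D: "D \<in> carrier_mat p k"
  shows "X * D = M \<and> Y * D = N \<longleftrightarrow> D = M + U * S * N"
proof -
  have UM: "mat_adjoint U * M = - (mat_adjoint W * N)"
    using mat_add_move[OF orth] M N by (simp add: cancel_mat_dim)
  have 1: "X * (M + U * S * N) = M" and 2: "Y * (M + U * S * N) = N"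
    using M N unfolding X_def Y_def
    by (simp_all add: mat_ring_simps shift_simps UM UM[THEN mult_mat_cong_left])
  have left: "D' = mat_adjoint X * (X * D') + mat_adjoint Y * (Y * D')" if "D' \<in> carrier_mat p k" for D'
    using arg_cong[OF column_relations(1), of "\<lambda>K. K * D'"] that by (simp add: mat_ring_simps)
  have "M + U * S * N \<in> carrier_mat p k" using M N by auto
  from left[OF this] left[OF D] 1 2 show ?thesis by metis
qed

text \<open>
  With Stein solution \<open>I\<close> and \<open>V = 0\<close>, all square roots and correction
  terms in the definition of the unitary pair become trivial.
\<close>

lemma tau_zero:
  "tau W U (0\<^sub>m p d) = (four_block_mat X U Y W, 1\<^sub>m (p + d))"
proof -
  have st: "stein_solution W U (0\<^sub>m p d) = 1\<^sub>m d"
    by (rule stein_solution_normalized[OF W U stable normalized])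
  have fst: "tau_fst W U (0\<^sub>m p d) = four_block_mat X U Y W"
  proof -
    have L: "mat_adjoint U * X + mat_adjoint W * Y = 0\<^sub>m d p" by (rule column_relations)
    have "tau_fst W U (0\<^sub>m p d) = four_block_mat X U Y W *
        four_block_mat (1\<^sub>m p) (0\<^sub>m p d) (0\<^sub>m d p) (1\<^sub>m d)"
      unfolding tau_fst_def Let_def st mat_sqrt_one mat_inv_one
      by (simp add: unit_mat_dim normalized mat_inv_one mat_sqrt_one column_relations L
          cancel_mat_dim(8) flip: R_def X_def Y_def)
    also have "\<dots> = four_block_mat X U Y W" by simp
    finally show ?thesis .
  qed
  have snd: "tau_snd W U (0\<^sub>m p d) = 1\<^sub>m (p + d)"
    unfolding tau_snd_def Let_def st mat_sqrt_one mat_inv_one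
    by (simp add: mat_adjoint_simps mat_inv_one mat_sqrt_one unit_mat_dim cancel_mat_dim)
  show ?thesis by (simp add: tau_def fst snd)
qed

end

section \<open>The elementary factor\<close>

lemma sign_mat_dim [simp]: "dim_row (sign_mat p) = p + p" "dim_col (sign_mat p) = p + p"
  by (simp_all add: sign_mat_def block_diag_def)

lemma append_cols_mult_sign_mat:
  assumes Z: "Z \<in> carrier_mat d p"
  shows "append_cols Z (0\<^sub>m d p) * sign_mat p = append_cols Z (0\<^sub>m d p)"
proof -
  have "append_cols Z (0\<^sub>m d p) * sign_mat p
      = append_cols (Z * 1\<^sub>m p + 0\<^sub>m d p * 0\<^sub>m p p) (Z * 0\<^sub>m p p + 0\<^sub>m d p * (- 1\<^sub>m p))"
    unfolding sign_mat_def block_diag_def using Z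
    by (simp add: append_cols_mult_four_block[of _ p p _ p _ p _ _ d])
  then show ?thesis using Z by (simp add: cancel_mat_dim(8))
qed

context interpolation_data
begin

text \<open>
  The transfer function of the unitary realization matrix with blocks \<open>X\<close>,
  \<open>U\<close>, \<open>Y\<close>, \<open>W\<close>.
\<close>

definition theta :: "complex poly fract mat" where
  "theta = const_mat X + const_mat U * (resolvent d W * const_mat Y)"

lemma theta_carrier [simp]: "theta \<in> carrier_mat p p"
  using resolvent(1)[OF W] by (auto simp: theta_def)

lemma theta_dim [simp]: "dim_row theta = p" "dim_col theta = p"
  using carrier_matD[OF theta_carrier] by auto

text \<open>
  The identity \<open>X + U S Y = I\<close> says that the elementary factor takes the value
  \<open>I\<close> at \<open>z = 1\<close>. Hence no constant correction is left for \<open>H\<close>.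
\<close>

lemma H_mat_zero: "H_mat p (tau W U (0\<^sub>m p d)) = 1\<^sub>m (2 * p)"
proof -
  have 1: "split_block (four_block_mat X U Y W) p p = (X, U, Y, W)"
    by (rule split_block_four_block[of _ p p _ d _ d]) auto
  have "split_block (four_block_mat (1\<^sub>m p) (0\<^sub>m p d) (0\<^sub>m d p) (1\<^sub>m d)) p p
      = (1\<^sub>m p, 0\<^sub>m p d, 0\<^sub>m d p, 1\<^sub>m d :: complex mat)"
    by (rule split_block_four_block[of _ p p _ d _ d]) auto
  then have 2: "split_block (1\<^sub>m (p + d)) p p = (1\<^sub>m p, 0\<^sub>m p d, 0\<^sub>m d p, 1\<^sub>m d :: complex mat)"
    by simp
  have "(U @\<^sub>r 0\<^sub>m p d) * S * append_cols Y (0\<^sub>m d p) * sign_mat p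
      = ((U * S) @\<^sub>r 0\<^sub>m p d) * append_cols Y (0\<^sub>m d p)"
    using S(1) by (simp add: append_rows_mult_mat[of _ p d _ p _ d] append_cols_mult_sign_mat
        assoc_mult_mat_dim unit_mat_dim)
  also have "\<dots> = four_block_mat (U * S * Y) (0\<^sub>m p p) (0\<^sub>m p p) (0\<^sub>m p p)"
    using S(1) by (subst append_rows_mult_append_cols[of _ p d _ p _ p _ p]) auto
  finally have 3: "(U @\<^sub>r 0\<^sub>m p d) * S * append_cols Y (0\<^sub>m d p) * sign_mat p
      = four_block_mat (U * S * Y) (0\<^sub>m p p) (0\<^sub>m p p) (0\<^sub>m p p)" .
  have XSY: "X + U * S * Y = 1\<^sub>m p"
    unfolding X_def Y_def by (simp add: mat_ring_simps shift_simps)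
  have "H_mat p (tau W U (0\<^sub>m p d))
      = four_block_mat X (0\<^sub>m p p) (0\<^sub>m p p) (1\<^sub>m p) + four_block_mat (U * S * Y) (0\<^sub>m p p) (0\<^sub>m p p) (0\<^sub>m p p)"
    unfolding H_mat_def tau_zero fst_conv snd_conv 1 2 Let_def prod.case S_def[symmetric] 3
    by (simp add: block_diag_def)
  also have "\<dots> = four_block_mat (X + U * S * Y) (0\<^sub>m p p + 0\<^sub>m p p) (0\<^sub>m p p + 0\<^sub>m p p) (1\<^sub>m p + 0\<^sub>m p p)"
    using S(1) by (intro add_four_block_mat[of _ p p _ p _ p]) auto
  also have "\<dots> = 1\<^sub>m (2 * p)" by (simp add: XSY mult_2)
  finally show ?thesis .
qed

text \<open>
  This is the upper left block of \<open>\<Theta>\<close>. It turns into a realization because \<open>z - 1\<close>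
  times the resolvent \<open>F\<close> of \<open>W\<close> is \<open>I - F (I - W)\<close>.
\<close>

lemma theta_alternative:
  "theta = 1\<^sub>m p - (rf_var - 1) \<cdot>\<^sub>m (const_mat U * resolvent d W * const_mat (R * mat_adjoint U))"
proof -
  note Phi = resolvent[OF W]
  let ?K = "const_mat (R * mat_adjoint U)"
  have K: "?K \<in> carrier_mat d p" using R(1) by auto
  have "rf_var \<cdot>\<^sub>m resolvent d W + - (resolvent d W * const_mat W) = 1\<^sub>m d"
    using Phi(1,3) unfolding pencil_def
    by (simp add: mult_add_mat_dim diff_mat_dim smult_mult_mat_dim unit_mat_dim mult_uminus_mat_dim)
  from mat_add_move[OF this]
  have var: "rf_var \<cdot>\<^sub>m resolvent d W = 1\<^sub>m d + resolvent d W * const_mat W"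
    using W by (simp add: cancel_mat_dim)
  have split: "(rf_var - 1) \<cdot>\<^sub>m M = rf_var \<cdot>\<^sub>m M + - M" for M :: "complex poly fract mat"
    by (auto intro!: eq_matI simp: algebra_simps)
  have "(rf_var - 1) \<cdot>\<^sub>m (const_mat U * resolvent d W * ?K)
      = const_mat U * (((rf_var - 1) \<cdot>\<^sub>m resolvent d W) * ?K)"
    using K by (simp add: assoc_mult_mat_dim smult_mult_mat_dim)
  also have "\<dots> = const_mat U * ((1\<^sub>m d + (resolvent d W * const_mat W + - resolvent d W)) * ?K)"
    by (simp add: split var add_assoc_mat_dim)
  finally have e: "(rf_var - 1) \<cdot>\<^sub>m (const_mat U * resolvent d W * ?K)
      = const_mat U * ((1\<^sub>m d + (resolvent d W * const_mat W + - resolvent d W)) * ?K)" .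
  show ?thesis
    unfolding e theta_def X_def Y_def by (simp add: const_mat_simps mat_ring_simps)
qed

lemma Theta_zero: "Theta W U (0\<^sub>m p d) = four_block_mat theta (0\<^sub>m p p) (0\<^sub>m p p) (1\<^sub>m p)"
proof -
  have st: "stein_solution W U (0\<^sub>m p d) = 1\<^sub>m d"
    by (rule stein_solution_normalized[OF W U stable normalized])
  let ?RU = "R * mat_adjoint U"
  have RU: "?RU \<in> carrier_mat d p" using R(1) by auto
  note Phi = resolvent[OF W]
  have 1: "mat_inv (1\<^sub>m d) * mat_adjoint (mat_inv (1\<^sub>m d - W)) * mat_adjoint (U @\<^sub>r 0\<^sub>m p d) * sign_mat p
      = append_cols ?RU (0\<^sub>m d p)"
  proof -
    have "mat_adjoint (U @\<^sub>r 0\<^sub>m p d) = append_cols (mat_adjoint U) (0\<^sub>m d p)"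
      by (simp add: mat_adjoint_append_rows[of _ p d _ p] mat_adjoint_simps)
    moreover have "R * append_cols (mat_adjoint U) (0\<^sub>m d p) = append_cols ?RU (0\<^sub>m d p)"
      using R(1) by (simp add: mat_mult_append_cols[of _ d d _ p _ p] unit_mat_dim)
    ultimately show ?thesis
      using RU by (simp add: mat_inv_one adjoint_R unit_mat_dim append_cols_mult_sign_mat flip: S_def)
  qed
  have "const_mat (U @\<^sub>r 0\<^sub>m p d) * resolvent d W * const_mat (append_cols ?RU (0\<^sub>m d p))
      = ((const_mat U * resolvent d W) @\<^sub>r 0\<^sub>m p d) * append_cols (const_mat ?RU) (0\<^sub>m d p)"
    using Phi(1) RU
    by (simp add: map_mat_append_rows[of _ _ p d _ p] map_mat_append_cols[of _ _ d p _ p] rf_const_0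
        const_mat_simps(7) append_rows_mult_mat[of _ p d _ p _ d] unit_mat_dim)
  also have "\<dots> = four_block_mat (const_mat U * resolvent d W * const_mat ?RU) (0\<^sub>m p p) (0\<^sub>m p p) (0\<^sub>m p p)"
    using Phi(1) RU by (subst append_rows_mult_append_cols[of _ p d _ p _ p _ p]) auto
  finally have 2: "const_mat (U @\<^sub>r 0\<^sub>m p d) * resolvent d W * const_mat (append_cols ?RU (0\<^sub>m d p))
      = four_block_mat (const_mat U * resolvent d W * const_mat ?RU) (0\<^sub>m p p) (0\<^sub>m p p) (0\<^sub>m p p)" .
  have "Theta W U (0\<^sub>m p d) = 1\<^sub>m (2 * p) - (rf_var - 1) \<cdot>\<^sub>m
      four_block_mat (const_mat U * resolvent d W * const_mat ?RU) (0\<^sub>m p p) (0\<^sub>m p p) (0\<^sub>m p p)"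
    unfolding Theta_def Let_def st data_dims 1
      2[unfolded resolvent_def pencil_def, symmetric] resolvent_def pencil_def ..
  also have "\<dots> = four_block_mat theta (0\<^sub>m p p) (0\<^sub>m p p) (1\<^sub>m p)"
    unfolding theta_alternative by (auto intro!: eq_matI simp del: index_mult_mat(1))
  finally show ?thesis .
qed

lemma Theta_hat_zero: "Theta_hat W U (0\<^sub>m p d) = four_block_mat theta (0\<^sub>m p p) (0\<^sub>m p p) (1\<^sub>m p)"
  unfolding Theta_hat_def data_dims H_mat_zero Theta_zero
  by (simp add: const_mat_simps unit_mat_dim mult_2)

lemma lft_zero:
  assumes G: "G \<in> carrier_mat p p"
  shows "lft_defined p (Theta_hat W U (0\<^sub>m p d)) G" "lft p (Theta_hat W U (0\<^sub>m p d)) G = theta * G"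
proof -
  have s: "split_block (Theta_hat W U (0\<^sub>m p d)) p p = (theta, 0\<^sub>m p p, 0\<^sub>m p p, 1\<^sub>m p)"
    unfolding Theta_hat_zero by (rule split_block_four_block[of _ p p _ p _ p]) auto
  have one: "0\<^sub>m p p * G + 1\<^sub>m p = 1\<^sub>m p" using G by simp
  show "lft_defined p (Theta_hat W U (0\<^sub>m p d)) G"
    unfolding lft_defined_def s Let_def prod.case one
    by (auto simp: invertible_mat_def inverts_mat_def intro!: exI[of _ "1\<^sub>m p"])
  show "lft p (Theta_hat W U (0\<^sub>m p d)) G = theta * G"
    unfolding lft_def s Let_def prod.case one mat_inv_one
    using G theta_carrier by (simp add: mat_ring_simps)
qed

text \<open>
  The realization of a product of two transfer functions is block triangular. Conversely, if the
  blocks of a triangular realization factor through \<open>X\<close> and \<open>Y\<close>, its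
  transfer function is such a product.
\<close>

lemma triangular_factorization:
  assumes Gt: "realization p (d + m) (four_block_mat W N (0\<^sub>m m d) A) (b @\<^sub>r B) (append_cols U Ch) Dt Gt"
    and N: "N \<in> carrier_mat d m" and A: "A \<in> carrier_mat m m"
    and b: "b \<in> carrier_mat d p" and B: "B \<in> carrier_mat m p" and Ch: "Ch \<in> carrier_mat p m"
    and C: "C \<in> carrier_mat p m" "X * C = Ch" "Y * C = N"
    and D: "D \<in> carrier_mat p p" "X * D = Dt" "Y * D = b"
  shows "Gt = theta * (const_mat D + const_mat C * resolvent m A * const_mat B)"
proof -
  note Phi = resolvent(1)[OF W] resolvent(1)[OF A]
  have XC: "const_mat Ch = const_mat X * const_mat C" "const_mat N = const_mat Y * const_mat C"
    "const_mat Dt = const_mat X * const_mat D" "const_mat b = const_mat Y * const_mat D"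
    using C(1) D(1) unfolding C(2,3)[symmetric] D(2,3)[symmetric] by (simp_all add: const_mat_simps)
  show ?thesis
    unfolding realization_triangular[OF Gt W N A b B U Ch] XC theta_def
    using Phi C(1) D(1) B A by (simp add: mat_ring_simps)
qed

text \<open>
  The second matrix of the unitary pair is the identity, so the recursion multiplies the outputs
  and the new states by the completed unitary matrix.
\<close>

lemma recursion_mat_zero:
  assumes A: "A' \<in> carrier_mat m m" and B: "B' \<in> carrier_mat m p"
    and C: "C' \<in> carrier_mat p m" and D: "D' \<in> carrier_mat p p"
  shows "recursion_mat p d m (tau W U (0\<^sub>m p d)) A' B' C' D' =
    four_block_mat (four_block_mat (X * D') U (Y * D') W) ((X * C') @\<^sub>r (Y * C'))
      (append_cols B' (0\<^sub>m m d)) A'"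
proof -
  let ?Q = "four_block_mat X U Y W"
  let ?M = "four_block_mat (block_diag D' (1\<^sub>m d)) (C' @\<^sub>r 0\<^sub>m d m) (append_cols B' (0\<^sub>m m d)) A'"
  have bd: "block_diag D' (1\<^sub>m d) = four_block_mat D' (0\<^sub>m p d) (0\<^sub>m d p) (1\<^sub>m d)"
    using D by (simp add: block_diag_def)
  have bQ: "block_diag ?Q (1\<^sub>m m) = four_block_mat ?Q (0\<^sub>m (p + d) m) (0\<^sub>m m (p + d)) (1\<^sub>m m)"
    by (simp add: block_diag_def)
  have Q: "?Q \<in> carrier_mat (p + d) (p + d)" by auto
  have 1: "block_diag (mat_adjoint (1\<^sub>m (p + d))) (1\<^sub>m m) = (1\<^sub>m (p + d + m) :: complex mat)"
    by (simp add: block_diag_def mat_adjoint_simps)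
  have M: "?M \<in> carrier_mat (p + d + m) (p + d + m)"
    using A B C D unfolding bd by auto
  have QD: "?Q * block_diag D' (1\<^sub>m d) = four_block_mat (X * D') U (Y * D') W"
  proof -
    have "?Q * block_diag D' (1\<^sub>m d) = four_block_mat (X * D' + U * 0\<^sub>m d p) (X * 0\<^sub>m p d + U * 1\<^sub>m d)
        (Y * D' + W * 0\<^sub>m d p) (Y * 0\<^sub>m p d + W * 1\<^sub>m d)"
      unfolding bd by (rule mult_four_block_mat) (use D in auto)
    then show ?thesis using D by (simp add: unit_mat_dim cancel_mat_dim)
  qed
  have QC: "?Q * (C' @\<^sub>r 0\<^sub>m d m) = (X * C') @\<^sub>r (Y * C')"
  proof -
    have "?Q * (C' @\<^sub>r 0\<^sub>m d m) = (X * C' + U * 0\<^sub>m d m) @\<^sub>r (Y * C' + W * 0\<^sub>m d m)"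
      by (rule four_block_mult_append_rows) (use C in auto)
    then show ?thesis using C by (simp add: unit_mat_dim cancel_mat_dim)
  qed
  have "block_diag ?Q (1\<^sub>m m) * ?M = four_block_mat
      (?Q * block_diag D' (1\<^sub>m d) + 0\<^sub>m (p + d) m * append_cols B' (0\<^sub>m m d))
      (?Q * (C' @\<^sub>r 0\<^sub>m d m) + 0\<^sub>m (p + d) m * A')
      (0\<^sub>m m (p + d) * block_diag D' (1\<^sub>m d) + 1\<^sub>m m * append_cols B' (0\<^sub>m m d))
      (0\<^sub>m m (p + d) * (C' @\<^sub>r 0\<^sub>m d m) + 1\<^sub>m m * A')"
    unfolding bQ by (rule mult_four_block_mat[OF Q]) (use A B C D bd in auto)
  also have "\<dots> = four_block_mat (four_block_mat (X * D') U (Y * D') W) ((X * C') @\<^sub>r (Y * C'))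
      (append_cols B' (0\<^sub>m m d)) A'"
  proof -
    have c: "append_cols B' (0\<^sub>m m d) \<in> carrier_mat m (p + d)" "C' @\<^sub>r 0\<^sub>m d m \<in> carrier_mat (p + d) m"
      "block_diag D' (1\<^sub>m d) \<in> carrier_mat (p + d) (p + d)"
      "(X * C') @\<^sub>r (Y * C') \<in> carrier_mat (p + d) m"
      "four_block_mat (X * D') U (Y * D') W \<in> carrier_mat (p + d) (p + d)"
      using D by (simp_all add: bd four_block_carrier_mat[OF mult_carrier_mat[OF X_carrier D] W] append_cols_carrier[OF B zero_carrier_mat]
          carrier_append_rows[OF C zero_carrier_mat]
          carrier_append_rows[OF mult_carrier_mat[OF X_carrier C] mult_carrier_mat[OF Y_carrier C]])
    then show ?thesis unfolding QD QC using A B C D by (simp add: unit_mat_dim cancel_mat_dim)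
  qed
  finally have "block_diag ?Q (1\<^sub>m m) * ?M = four_block_mat (four_block_mat (X * D') U (Y * D') W)
      ((X * C') @\<^sub>r (Y * C')) (append_cols B' (0\<^sub>m m d)) A'" .
  moreover have "block_diag ?Q (1\<^sub>m m) * ?M * 1\<^sub>m (p + d + m) = block_diag ?Q (1\<^sub>m m) * ?M"
  proof (rule right_mult_one_mat[OF mult_carrier_mat[OF _ M]])
    show "block_diag ?Q (1\<^sub>m m) \<in> carrier_mat (p + d + m) (p + d + m)"
      unfolding bQ using Q by auto
  qed
  ultimately show ?thesis
    unfolding recursion_mat_def tau_zero fst_conv snd_conv 1 by (rule trans[rotated])
qed

end

section \<open>Unitarity of the remaining realization\<close>

text \<open>
  The columns of the realization matrix that belong to the first \<open>d\<close> states contain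
  only \<open>U\<close> and \<open>W\<close>, because the dynamics matrix is triangular. Their
  orthonormality yields the normalization of the interpolation data, and their orthogonality to
  the other columns is what makes the remaining blocks factor through \<open>X\<close> and
  \<open>Y\<close>.
\<close>

lemma unitary_triangular_realization:
  assumes u: "unitary_mat (four_block_mat Dt (append_cols U Ch) (b @\<^sub>r B) (four_block_mat W N (0\<^sub>m m d) A))"
    and c: "Dt \<in> carrier_mat p p" "U \<in> carrier_mat p d" "Ch \<in> carrier_mat p m"
    "b \<in> carrier_mat d p" "W \<in> carrier_mat d d" "N \<in> carrier_mat d m"
    "B \<in> carrier_mat m p" "A \<in> carrier_mat m m"
  shows "mat_adjoint U * U + mat_adjoint W * W = 1\<^sub>m d"
    "mat_adjoint U * Dt + mat_adjoint W * b = 0\<^sub>m d p"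
    "mat_adjoint U * Ch + mat_adjoint W * N = 0\<^sub>m d m"
    "unitary_mat (four_block_mat (four_block_mat Dt U b W) (Ch @\<^sub>r N) (append_cols B (0\<^sub>m m d)) A)"
proof -
  let ?At = "four_block_mat W N (0\<^sub>m m d) A"
  have C: "append_cols U Ch \<in> carrier_mat p (d + m)" and B: "b @\<^sub>r B \<in> carrier_mat (d + m) p"
    and A: "?At \<in> carrier_mat (d + m) (d + m)"
    using c by auto
  note rel = unitary_four_block[OF u c(1) C B A]
  have adjC: "mat_adjoint (append_cols U Ch) = mat_adjoint U @\<^sub>r mat_adjoint Ch"
    by (rule mat_adjoint_append_cols[OF c(2,3)])
  have adjA: "mat_adjoint ?At = four_block_mat (mat_adjoint W) (0\<^sub>m d m) (mat_adjoint N) (mat_adjoint A)"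
    using mat_adjoint_four_block[OF c(5,6) zero_carrier_mat c(8)] by (simp add: mat_adjoint_simps)
  have "mat_adjoint (append_cols U Ch) * append_cols U Ch + mat_adjoint ?At * ?At
    = four_block_mat (mat_adjoint U * U) (mat_adjoint U * Ch) (mat_adjoint Ch * U) (mat_adjoint Ch * Ch)
    + four_block_mat (mat_adjoint W * W + 0\<^sub>m d m * 0\<^sub>m m d) (mat_adjoint W * N + 0\<^sub>m d m * A)
        (mat_adjoint N * W + mat_adjoint A * 0\<^sub>m m d) (mat_adjoint N * N + mat_adjoint A * A)"
    unfolding adjC adjA
    using append_rows_mult_append_cols[OF mat_adjoint_carrier[OF c(2)] mat_adjoint_carrier[OF c(3)] c(2,3)]
      mult_four_block_mat[OF mat_adjoint_carrier[OF c(5)] zero_carrier_mat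
        mat_adjoint_carrier[OF c(6)] mat_adjoint_carrier[OF c(8)] c(5,6) zero_carrier_mat c(8)]
    by simp
  also have "\<dots> = four_block_mat
      (mat_adjoint U * U + (mat_adjoint W * W + 0\<^sub>m d m * 0\<^sub>m m d))
      (mat_adjoint U * Ch + (mat_adjoint W * N + 0\<^sub>m d m * A))
      (mat_adjoint Ch * U + (mat_adjoint N * W + mat_adjoint A * 0\<^sub>m m d))
      (mat_adjoint Ch * Ch + (mat_adjoint N * N + mat_adjoint A * A))"
    using c by (intro add_four_block_mat[of _ d d _ m _ m]) auto
  finally have e: "\<dots> = four_block_mat (1\<^sub>m d) (0\<^sub>m d m) (0\<^sub>m m d) (1\<^sub>m m)"
    using rel(4) by simp
  have "mat_adjoint U * U + (mat_adjoint W * W + 0\<^sub>m d m * 0\<^sub>m m d) = 1\<^sub>m d"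
    "mat_adjoint U * Ch + (mat_adjoint W * N + 0\<^sub>m d m * A) = 0\<^sub>m d m"
    by (rule four_block_mat_inject[OF e, of d d m m]; use c in auto)+
  then show "mat_adjoint U * U + mat_adjoint W * W = 1\<^sub>m d"
    "mat_adjoint U * Ch + mat_adjoint W * N = 0\<^sub>m d m"
    using c by (simp_all add: unit_mat_dim cancel_mat_dim)
  have "mat_adjoint (append_cols U Ch) * Dt + mat_adjoint ?At * (b @\<^sub>r B)
    = ((mat_adjoint U * Dt) @\<^sub>r (mat_adjoint Ch * Dt))
      + ((mat_adjoint W * b + 0\<^sub>m d m * B) @\<^sub>r (mat_adjoint N * b + mat_adjoint A * B))"
    unfolding adjC adjA using c
    by (simp add: append_rows_mult_mat[of _ d p _ m _ p] four_block_mult_append_rows[of _ d d _ m _ m _ _ p])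
  also have "\<dots> = (mat_adjoint U * Dt + (mat_adjoint W * b + 0\<^sub>m d m * B))
      @\<^sub>r (mat_adjoint Ch * Dt + (mat_adjoint N * b + mat_adjoint A * B))"
    using c by (intro append_rows_add[of _ d p _ m]) auto
  finally have e: "\<dots> = 0\<^sub>m d p @\<^sub>r 0\<^sub>m m p" using rel(3) by (simp add: append_rows_zero)
  have "mat_adjoint U * Dt + (mat_adjoint W * b + 0\<^sub>m d m * B) = 0\<^sub>m d p"
    by (rule append_rows_inject(1)[OF e, of d p m]) (use c in auto)
  then show "mat_adjoint U * Dt + mat_adjoint W * b = 0\<^sub>m d p"
    using c by (simp add: unit_mat_dim cancel_mat_dim)
  show "unitary_mat (four_block_mat (four_block_mat Dt U b W) (Ch @\<^sub>r N) (append_cols B (0\<^sub>m m d)) A)"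
    using u unfolding four_block_repartition[OF c] .
qed

context interpolation_data
begin

text \<open>
  Undoing the recursion multiplies the unitary realization matrix by the adjoint of a unitary
  matrix and drops the \<open>d\<close> states that then decouple, so the rows of the remaining
  matrix are orthonormal. The row relations are read off blockwise and transported by
  \<open>X\<^sup>* X + Y\<^sup>* Y = I\<close>.
\<close>

lemma unitary_remainder:
  assumes u: "unitary_mat (four_block_mat (four_block_mat Dt U b W) (Ch @\<^sub>r N) (append_cols B (0\<^sub>m m d)) A)"
    and A: "A \<in> carrier_mat m m" and B: "B \<in> carrier_mat m p"
    and C: "C \<in> carrier_mat p m" "X * C = Ch" "Y * C = N"
    and D: "D \<in> carrier_mat p p" "X * D = Dt" "Y * D = b"
  shows "D * mat_adjoint D + C * mat_adjoint C = 1\<^sub>m p"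
    "D * mat_adjoint B + C * mat_adjoint A = 0\<^sub>m p m"
    "B * mat_adjoint D + A * mat_adjoint C = 0\<^sub>m m p"
    "B * mat_adjoint B + A * mat_adjoint A = 1\<^sub>m m"
proof -
  have c: "Dt \<in> carrier_mat p p" "b \<in> carrier_mat d p" "Ch \<in> carrier_mat p m" "N \<in> carrier_mat d m"
    using D C by auto
  let ?Q = "four_block_mat Dt U b W"
  have Q: "?Q \<in> carrier_mat (p + d) (p + d)" and ChN: "Ch @\<^sub>r N \<in> carrier_mat (p + d) m"
    and B0: "append_cols B (0\<^sub>m m d) \<in> carrier_mat m (p + d)"
    using four_block_carrier_mat[OF c(1) W] carrier_append_rows[OF c(3,4)]
      append_cols_carrier[OF B zero_carrier_mat] by auto
  note rel = unitary_four_block[OF u Q ChN B0 A]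
  have adjQ: "mat_adjoint ?Q = four_block_mat (mat_adjoint Dt) (mat_adjoint b) (mat_adjoint U) (mat_adjoint W)"
    by (rule mat_adjoint_four_block[OF c(1) U c(2) W])
  have adjC: "mat_adjoint (Ch @\<^sub>r N) = append_cols (mat_adjoint Ch) (mat_adjoint N)"
    by (rule mat_adjoint_append_rows[OF c(3,4)])
  have adjB: "mat_adjoint (append_cols B (0\<^sub>m m d)) = mat_adjoint B @\<^sub>r 0\<^sub>m d m"
    by (simp add: mat_adjoint_append_cols[OF B zero_carrier_mat] mat_adjoint_simps)
  have BB: "append_cols B (0\<^sub>m m d) * (mat_adjoint B @\<^sub>r 0\<^sub>m d m) = B * mat_adjoint B"
    using B by (simp add: append_cols_mult_append_rows[OF B zero_carrier_mat, of _ m])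
  show "B * mat_adjoint B + A * mat_adjoint A = 1\<^sub>m m"
    using rel(8) by (simp add: adjB BB)
  have "?Q * (mat_adjoint B @\<^sub>r 0\<^sub>m d m) + (Ch @\<^sub>r N) * mat_adjoint A
     = ((Dt * mat_adjoint B + U * 0\<^sub>m d m) @\<^sub>r (b * mat_adjoint B + W * 0\<^sub>m d m))
      + ((Ch * mat_adjoint A) @\<^sub>r (N * mat_adjoint A))"
    using B A by (simp add: four_block_mult_append_rows[OF c(1) U c(2) W, of _ m]
        append_rows_mult_mat[OF c(3,4), of _ m])
  also have "\<dots> = (Dt * mat_adjoint B + U * 0\<^sub>m d m + Ch * mat_adjoint A)
      @\<^sub>r (b * mat_adjoint B + W * 0\<^sub>m d m + N * mat_adjoint A)"
    using A B c U W by (intro append_rows_add[of _ p m _ d]) auto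
  finally have e: "\<dots> = 0\<^sub>m p m @\<^sub>r 0\<^sub>m d m"
    using rel(6) by (simp add: adjB append_rows_zero)
  have "Dt * mat_adjoint B + U * 0\<^sub>m d m + Ch * mat_adjoint A = 0\<^sub>m p m"
    "b * mat_adjoint B + W * 0\<^sub>m d m + N * mat_adjoint A = 0\<^sub>m d m"
    by (rule append_rows_inject[OF e, of p m d]; use A B c U W in auto)+
  then have r12: "Dt * mat_adjoint B + Ch * mat_adjoint A = 0\<^sub>m p m"
    "b * mat_adjoint B + N * mat_adjoint A = 0\<^sub>m d m"
    using c B by (simp_all add: unit_mat_dim cancel_mat_dim)
  have XX: "E = mat_adjoint X * (X * E) + mat_adjoint Y * (Y * E)" if "E \<in> carrier_mat p k" for E k
    using arg_cong[OF column_relations(1), of "\<lambda>K. K * E"] that by (simp add: mat_ring_simps)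
  have "D * mat_adjoint B + C * mat_adjoint A
      = mat_adjoint X * (Dt * mat_adjoint B + Ch * mat_adjoint A)
        + mat_adjoint Y * (b * mat_adjoint B + N * mat_adjoint A)"
    using XX[of "D * mat_adjoint B + C * mat_adjoint A" m] A B C(1) D(1)
    unfolding C(2,3)[symmetric] D(2,3)[symmetric] by (simp add: mat_ring_simps)
  then show DB: "D * mat_adjoint B + C * mat_adjoint A = 0\<^sub>m p m"
    unfolding r12 by (simp add: unit_mat_dim cancel_mat_dim)
  show "B * mat_adjoint D + A * mat_adjoint C = 0\<^sub>m m p"
    using arg_cong[OF DB, of mat_adjoint] A B C D by (simp add: mat_adjoint_simps)
  have "?Q * mat_adjoint ?Q + (Ch @\<^sub>r N) * mat_adjoint (Ch @\<^sub>r N)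
    = four_block_mat (Dt * mat_adjoint Dt + U * mat_adjoint U) (Dt * mat_adjoint b + U * mat_adjoint W)
        (b * mat_adjoint Dt + W * mat_adjoint U) (b * mat_adjoint b + W * mat_adjoint W)
      + four_block_mat (Ch * mat_adjoint Ch) (Ch * mat_adjoint N) (N * mat_adjoint Ch) (N * mat_adjoint N)"
    unfolding adjQ adjC using c
    by (simp add: mult_four_block_mat[OF c(1) U c(2) W, of _ p _ d]
        append_rows_mult_append_cols[OF c(3,4), of _ p _ d])
  also have "\<dots> = four_block_mat
      (Dt * mat_adjoint Dt + U * mat_adjoint U + Ch * mat_adjoint Ch)
      (Dt * mat_adjoint b + U * mat_adjoint W + Ch * mat_adjoint N)
      (b * mat_adjoint Dt + W * mat_adjoint U + N * mat_adjoint Ch)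
      (b * mat_adjoint b + W * mat_adjoint W + N * mat_adjoint N)"
    using c W U by (intro add_four_block_mat[of _ p p _ d _ d]) auto
  finally have e: "\<dots> = four_block_mat (1\<^sub>m p) (0\<^sub>m p d) (0\<^sub>m d p) (1\<^sub>m d)"
    using rel(5) by simp
  have r11: "Dt * mat_adjoint Dt + U * mat_adjoint U + Ch * mat_adjoint Ch = 1\<^sub>m p"
    "Dt * mat_adjoint b + U * mat_adjoint W + Ch * mat_adjoint N = 0\<^sub>m p d"
    "b * mat_adjoint Dt + W * mat_adjoint U + N * mat_adjoint Ch = 0\<^sub>m d p"
    "b * mat_adjoint b + W * mat_adjoint W + N * mat_adjoint N = 1\<^sub>m d"
    by (rule four_block_mat_inject[OF e, of p p d d]; use c W U in auto)+
  let ?S = "D * mat_adjoint D + C * mat_adjoint C"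
  have S: "?S \<in> carrier_mat p p" using C D by auto
  have blocks: "X * ?S * mat_adjoint X + U * mat_adjoint U = 1\<^sub>m p"
    "X * ?S * mat_adjoint Y + U * mat_adjoint W = 0\<^sub>m p d"
    "Y * ?S * mat_adjoint X + W * mat_adjoint U = 0\<^sub>m d p"
    "Y * ?S * mat_adjoint Y + W * mat_adjoint W = 1\<^sub>m d"
    using r11 C(1) D(1) unfolding C(2,3)[symmetric] D(2,3)[symmetric]
    by (simp_all add: mat_ring_simps mat_adjoint_simps)
  have moved: "X * (?S * mat_adjoint X) = 1\<^sub>m p + - (U * mat_adjoint U)"
    "X * (?S * mat_adjoint Y) = - (U * mat_adjoint W)"
    "Y * (?S * mat_adjoint X) = - (W * mat_adjoint U)"
    "Y * (?S * mat_adjoint Y) = 1\<^sub>m d + - (W * mat_adjoint W)"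
    using mat_add_move[OF blocks(1)] mat_add_move[OF blocks(2)] mat_add_move[OF blocks(3)]
      mat_add_move[OF blocks(4)] C D by (simp_all add: assoc_mult_mat_dim cancel_mat_dim)
  have XXr: "E = E * mat_adjoint X * X + E * mat_adjoint Y * Y" if "E \<in> carrier_mat p p" for E
    using arg_cong[OF column_relations(1), of "\<lambda>K. E * K"] that by (simp add: mat_ring_simps)
  \<comment> \<open>Conjugating by the completed unitary matrix turns \<open>?S\<close> into known
    blocks; what remains besides
    \<open>X\<^sup>* X + Y\<^sup>* Y\<close> has the factor \<open>X\<^sup>* U + Y\<^sup>* W = 0\<close>.\<close>
  have "?S = (mat_adjoint X * (X * (?S * mat_adjoint X)) + mat_adjoint Y * (Y * (?S * mat_adjoint X))) * X
      + (mat_adjoint X * (X * (?S * mat_adjoint Y)) + mat_adjoint Y * (Y * (?S * mat_adjoint Y))) * Y"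
  proof -
    have "?S * mat_adjoint X \<in> carrier_mat p p" "?S * mat_adjoint Y \<in> carrier_mat p d"
      using mult_carrier_mat[OF S mat_adjoint_carrier[OF X_carrier]]
        mult_carrier_mat[OF S mat_adjoint_carrier[OF Y_carrier]] by auto
    note e = XX[OF this(1), symmetric] XX[OF this(2), symmetric]
    show ?thesis unfolding e by (rule XXr[OF S])
  qed
  also have "\<dots> = (mat_adjoint X * X + mat_adjoint Y * Y)
      + - ((mat_adjoint X * U + mat_adjoint Y * W) * (mat_adjoint U * X + mat_adjoint W * Y))"
    unfolding moved by (simp add: mat_ring_simps)
  also have "\<dots> = 1\<^sub>m p"
    unfolding column_relations by (simp add: unit_mat_dim cancel_mat_dim)
  finally show "?S = 1\<^sub>m p" .
qed

end

section \<open>Real matrices and triangular structure\<close>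

lemma real_mat_iff_cnj: "real_mat M \<longleftrightarrow> map_mat cnj M = M"
proof -
  have "map_mat cnj M = M \<longleftrightarrow> (\<forall>i<dim_row M. \<forall>j<dim_col M. cnj (M $$ (i, j)) = M $$ (i, j))"
    by (auto simp: mat_eq_iff)
  also have "\<dots> \<longleftrightarrow> real_mat M"
    by (simp add: real_mat_def elements_mat_def UN_subset_iff image_subset_iff Reals_cnj_iff Ball_def)
  finally show ?thesis ..
qed

lemma comm_ring_hom_cnj: "comm_ring_hom cnj"
  by unfold_locales auto

lemmas cnj_mat_simps = comm_ring_hom.map_mat_dim[OF comm_ring_hom_cnj]

lemma cnj_mat_inv:
  assumes "M \<in> carrier_mat n n" "mat_inv M \<in> carrier_mat n n" "M * mat_inv M = 1\<^sub>m n" "map_mat cnj M = M"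
  shows "map_mat cnj (mat_inv M) = mat_inv M"
proof -
  have "map_mat cnj M * map_mat cnj (mat_inv M) = 1\<^sub>m n"
    using arg_cong[OF assms(3), of "map_mat cnj"] assms(1,2) by (simp add: cnj_mat_simps)
  then show ?thesis using mat_inv_eqI[of M n "map_mat cnj (mat_inv M)"] assms by auto
qed

lemma stable_triangular:
  assumes st: "stable_mat (four_block_mat W N (0\<^sub>m m d) A)"
    and c: "W \<in> carrier_mat d d" "N \<in> carrier_mat d m" "A \<in> carrier_mat m m"
  shows "stable_mat W" "stable_mat A"
proof -
  have "char_poly (four_block_mat W N (0\<^sub>m m d) A) = char_poly W * char_poly A"
    using char_poly_factorized[OF c(1)] char_poly_factorized[OF c(3)] c
    by (intro char_poly_0_block[OF refl]) auto
  moreover have "four_block_mat W N (0\<^sub>m m d) A \<in> carrier_mat (d + m) (d + m)" using c by auto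
  ultimately have "eigenvalue (four_block_mat W N (0\<^sub>m m d) A) e"
    if "eigenvalue W e \<or> eigenvalue A e" for e
    using that eigenvalue_root_char_poly[OF c(1)] eigenvalue_root_char_poly[OF c(3)]
      eigenvalue_root_char_poly[of _ "d + m"] by (metis mult_eq_0_iff poly_mult)
  then show "stable_mat W" "stable_mat A" using st by (auto simp: stable_mat_def)
qed

lemma block_upper_triangular_square: "block_upper_triangular Ws M \<Longrightarrow> square_mat M"
  by (induction Ws arbitrary: M) auto

lemma block_upper_triangular_Cons:
  assumes "block_upper_triangular (W # Ws) (four_block_mat W N (0\<^sub>m m d) A)"
    and c: "W \<in> carrier_mat d d" "N \<in> carrier_mat d m" "A \<in> carrier_mat m m"
  shows "block_upper_triangular Ws A"
proof -
  obtain N' M' where M': "N' \<in> carrier_mat (dim_row W) (dim_row M')" "block_upper_triangular Ws M'"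
    and e: "four_block_mat W N (0\<^sub>m m d) A = four_block_mat W N' (0\<^sub>m (dim_row M') (dim_col W)) M'"
    using assms(1) by auto
  have "dim_row M' = m" using arg_cong[OF e, of dim_row] c by simp
  with M' block_upper_triangular_square[OF M'(2)] c have "M' \<in> carrier_mat m m" "N' \<in> carrier_mat d m" by auto
  then have "A = M'" using four_block_mat_inject(4)[OF e[unfolded \<open>dim_row M' = m\<close>], of d d m m] c by auto
  then show ?thesis using M'(2) by simp
qed

context interpolation_data
begin

lemma cnj_S:
  assumes "map_mat cnj W = W"
  shows "map_mat cnj S = S"
proof -
  have M: "1\<^sub>m d - W \<in> carrier_mat d d" by (auto simp: W)
  show ?thesis
    using cnj_mat_inv[OF M] S(1,2) assms unfolding S_def by (simp add: cnj_mat_simps)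
qed

end

section \<open>Splitting off the leading block\<close>

theorem lemma2:
  fixes p n l nl :: nat
    and Gt :: "complex poly fract mat"
    and At Bt Ct Dt A B Ah Bh Ch U :: "complex mat"
    and W :: "nat \<Rightarrow> complex mat"
  assumes "Gt \<in> RL n p"
    and "balanced_realization p n At Bt Ct Dt Gt"
    and "1 \<le> l"
    and "real_schur_quadruple (map W (rev [1..<Suc l])) At Bt Ct Dt"
    and "W l \<in> carrier_mat nl nl"
    and "U \<in> carrier_mat p nl"
    and "Bh \<in> carrier_mat p nl"
    and "Ch \<in> carrier_mat p (n - nl)"
    and "Ah \<in> carrier_mat (n - nl) nl"
    and "A \<in> carrier_mat (n - nl) (n - nl)"
    and "B \<in> carrier_mat (n - nl) p"
    and "At = four_block_mat (W l) (mat_adjoint Ah) (0\<^sub>m (n - nl) nl) A"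
    and "Ct = append_cols U Ch"
    and "Bt = mat_adjoint Bh @\<^sub>r B"
  shows "admissible p nl (W l) U (0\<^sub>m p nl) \<and>
    (let C = Ch + U * mat_inv (1\<^sub>m nl - W l) * mat_adjoint Ah;
         D = Dt + U * mat_inv (1\<^sub>m nl - W l) * mat_adjoint Bh
     in (\<exists>G. lossless p G \<and>
             lft_defined p (Theta_hat (W l) U (0\<^sub>m p nl)) G \<and>
             Gt = lft p (Theta_hat (W l) U (0\<^sub>m p nl)) G \<and>
             realization p (n - nl) A B C D G) \<and>
        (\<forall>A' \<in> carrier_mat (n - nl) (n - nl). \<forall>B' \<in> carrier_mat (n - nl) p.
         \<forall>C' \<in> carrier_mat p (n - nl). \<forall>D' \<in> carrier_mat p p.
           four_block_mat Dt Ct Bt At =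
             recursion_mat p nl (n - nl) (tau (W l) U (0\<^sub>m p nl)) A' B' C' D' \<longleftrightarrow>
           (A', B', C', D') = (A, B, C, D)) \<and>
        real_schur_quadruple (map W (rev [1..<l])) A B C D)"
proof -
  define d where "d = nl"
  define m where "m = n - nl"
  define N where "N = mat_adjoint Ah"
  define b where "b = mat_adjoint Bh"
  note bal = assms(2)
  have Rt: "realization p n At Bt Ct Dt Gt" and u: "unitary_mat (four_block_mat Dt Ct Bt At)"
    using bal by (auto simp: balanced_realization_def minimal_realization_def)
  have c: "U \<in> carrier_mat p d" "Ch \<in> carrier_mat p m" "b \<in> carrier_mat d p" "W l \<in> carrier_mat d d"
    "N \<in> carrier_mat d m" "B \<in> carrier_mat m p" "A \<in> carrier_mat m m"
    using assms by (auto simp: d_def m_def N_def b_def)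
  have Dt: "Dt \<in> carrier_mat p p" and Atc: "At \<in> carrier_mat n n"
    using Rt unfolding realization_def by blast+
  have At: "At = four_block_mat (W l) N (0\<^sub>m m d) A" and Ct: "Ct = append_cols U Ch" and Bt: "Bt = b @\<^sub>r B"
    using assms by (simp_all add: d_def m_def N_def b_def)
  have n: "n = d + m"
    using arg_cong[OF At, of dim_row] Atc c by simp
  have stab: "stable_mat (W l)" "stable_mat A"
    using stable_triangular[OF balanced_realization_stable[OF bal, unfolded At] c(4,5,7)] by auto
  note tri = unitary_triangular_realization[OF u[unfolded At Bt Ct] Dt c]
  interpret interpolation_data p d "W l" U
    by unfold_locales (use c stab tri in auto)
  define C where "C = Ch + U * S * N"
  define D where "D = Dt + U * S * b"
  have C: "C \<in> carrier_mat p m" and D: "D \<in> carrier_mat p p"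
    using c Dt S(1) by (auto simp: C_def D_def)
  have C_iff: "X * C' = Ch \<and> Y * C' = N \<longleftrightarrow> C' = C" if "C' \<in> carrier_mat p m" for C'
    unfolding C_def by (rule XY_complete[OF c(2,5) tri(3) that])
  have D_iff: "X * D' = Dt \<and> Y * D' = b \<longleftrightarrow> D' = D" if "D' \<in> carrier_mat p p" for D'
    unfolding D_def by (rule XY_complete[OF Dt c(3) tri(2) that])
  have XC: "X * C = Ch" "Y * C = N" and XD: "X * D = Dt" "Y * D = b"
    using C_iff[OF C] D_iff[OF D] by auto
  define G where "G = const_mat D + const_mat C * resolvent m A * const_mat B"
  have G: "realization p m A B C D G"
    using c C D by (simp add: realization_iff_resolvent G_def)
  have lossless: "lossless p G"
    by (rule unitary_realization_lossless[OF G stab(2)])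
      (rule unitary_remainder[OF tri(4) c(7,6) C XC D XD])+
  have Gc: "G \<in> carrier_mat p p" using lossless by (simp add: lossless_def)
  have "Gt = theta * G"
    unfolding G_def
    by (rule triangular_factorization[OF Rt[unfolded n At Bt Ct] c(5,7,3,6,2) C XC D XD])
  then have lft: "Gt = lft p (Theta_hat (W l) U (0\<^sub>m p d)) G"
    by (simp add: lft_zero(2)[OF Gc])
  have admissible: "admissible p d (W l) U (0\<^sub>m p d)"
    using c stab(1) tri(1) output_normal_observable[OF c(4) stab(1) c(1) tri(1)]
    by (simp add: admissible_def stein_solution_normalized[OF c(4,1) stab(1) tri(1)] pos_def_one)
  have recursion: "four_block_mat Dt Ct Bt At = recursion_mat p d m (tau (W l) U (0\<^sub>m p d)) A' B' C' D'
      \<longleftrightarrow> (A', B', C', D') = (A, B, C, D)"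
    if c': "A' \<in> carrier_mat m m" "B' \<in> carrier_mat m p" "C' \<in> carrier_mat p m" "D' \<in> carrier_mat p p"
    for A' B' C' D'
  proof -
    have "four_block_mat Dt Ct Bt At = recursion_mat p d m (tau (W l) U (0\<^sub>m p d)) A' B' C' D' \<longleftrightarrow>
      four_block_mat (four_block_mat Dt U b (W l)) (Ch @\<^sub>r N) (append_cols B (0\<^sub>m m d)) A
      = four_block_mat (four_block_mat (X * D') U (Y * D') (W l)) ((X * C') @\<^sub>r (Y * C'))
          (append_cols B' (0\<^sub>m m d)) A'"
      unfolding At Bt Ct four_block_repartition[OF Dt c] recursion_mat_zero[OF c'] ..
    also have "\<dots> \<longleftrightarrow> (X * D' = Dt \<and> Y * D' = b) \<and> (X * C' = Ch \<and> Y * C' = N) \<and> B' = B \<and> A' = A"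
      (is "?l \<longleftrightarrow> ?r")
    proof
      assume eq: ?l
      have XD': "X * D' \<in> carrier_mat p p" "Y * D' \<in> carrier_mat d p"
        and XC': "X * C' \<in> carrier_mat p m" "Y * C' \<in> carrier_mat d m"
        using mult_carrier_mat[OF X_carrier c'(4)] mult_carrier_mat[OF Y_carrier c'(4)]
          mult_carrier_mat[OF X_carrier c'(3)] mult_carrier_mat[OF Y_carrier c'(3)] by auto
      note inj = four_block_mat_inject[OF eq four_block_carrier_mat[OF Dt c(4)]
          carrier_append_rows[OF c(2,5)] append_cols_carrier[OF c(6) zero_carrier_mat] c(7)
          four_block_carrier_mat[OF XD'(1) c(4)] carrier_append_rows[OF XC']
          append_cols_carrier[OF c'(2) zero_carrier_mat] c'(1)]
      from four_block_mat_inject(1,3)[OF inj(1) Dt c(1,3,4) XD'(1) c(1) XD'(2) c(4)]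
        append_rows_inject[OF inj(2) c(2,5) XC']
        append_cols_inject(1)[OF inj(3) c(6) zero_carrier_mat c'(2) zero_carrier_mat] inj(4)
      show ?r by simp
    next
      assume ?r then show ?l by simp
    qed
    also have "\<dots> \<longleftrightarrow> (A', B', C', D') = (A, B, C, D)"
      unfolding C_iff[OF c'(3)] D_iff[OF c'(4)] by auto
    finally show ?thesis .
  qed
  have Ws: "map W (rev [1..<Suc l]) = W l # map W (rev [1..<l])" using assms(3) by simp
  have schur: "real_schur_quadruple (map W (rev [1..<l])) A B C D"
  proof -
    have sch: "real_mat At" "\<forall>V \<in> set (W l # map W (rev [1..<l])). schur_block V"
      "block_upper_triangular (W l # map W (rev [1..<l])) At" and re: "real_mat Bt" "real_mat Ct" "real_mat Dt"
      using assms(4) unfolding real_schur_quadruple_def real_schur_form_def Ws by auto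
    have "four_block_mat (map_mat cnj (W l)) (map_mat cnj N) (0\<^sub>m m d) (map_mat cnj A)
        = four_block_mat (W l) N (0\<^sub>m m d) A"
      using sch(1) c unfolding real_mat_iff_cnj At
      by (simp add: map_four_block_mat[of _ d d _ m _ m] cnj_mat_simps)
    note Ar = four_block_mat_inject[OF this, of d d m m]
    have "append_cols (map_mat cnj U) (map_mat cnj Ch) = append_cols U Ch"
      using re(2) c unfolding real_mat_iff_cnj Ct by (simp add: map_mat_append_cols[of _ _ p d _ m])
    note Cr = append_cols_inject[OF this, of p d m]
    have "map_mat cnj b @\<^sub>r map_mat cnj B = b @\<^sub>r B"
      using re(1) c unfolding real_mat_iff_cnj Bt by (simp add: map_mat_append_rows[of _ _ d p _ m])
    note Br = append_rows_inject[OF this, of d p m]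
    have r: "map_mat cnj (W l) = W l" "map_mat cnj N = N" "map_mat cnj A = A" "map_mat cnj U = U"
      "map_mat cnj Ch = Ch" "map_mat cnj b = b" "map_mat cnj B = B" "map_mat cnj Dt = Dt"
      using Ar Cr Br c re(3) by (auto simp: real_mat_iff_cnj)
    note rS = cnj_S[OF r(1)]
    have "map_mat cnj C = C" "map_mat cnj D = D"
      using c Dt unfolding C_def D_def by (simp_all add: cnj_mat_simps r rS)
    moreover have "block_upper_triangular (map W (rev [1..<l])) A"
      by (rule block_upper_triangular_Cons[OF sch(3)[unfolded At] c(4,5,7)])
    ultimately show ?thesis
      using sch(2) r by (simp add: real_schur_quadruple_def real_schur_form_def real_mat_iff_cnj)
  qed
  show ?thesis
    unfolding Let_def
    using admissible lossless lft_zero(1)[OF Gc] lft G recursion schur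
    unfolding C_def D_def S_def
    unfolding b_def N_def d_def m_def by blast
qed

end
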